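(* Let $n\ge 0$ and let $\kappa=(\xi,\eta)\in S\$\Gamma_{n+1}$ be a Lipschitz spinor. Then, in the upper half-space model $\mathbb{U}^{n+2}$, $\Phi(\kappa)$ is a horosphere decorated with $n$ parallel oriented line fields (labelled $i_1,\dots,i_n$) and centred at $\xi\eta^{-1}\in\$\mathbb{R}^{n+1}\cup\{\infty\}$ (taken to be $\infty$ if $\eta=0$). Moreover: \begin{itemize} \item If $\eta\neq 0$, the horosphere has Euclidean diameter $|\eta|^{-2}$, and the north pole specification of the $i_j$ line field is $\eta' i_j\overline{\eta}$. \item If $\eta=0$, the horosphere has Euclidean height $|\xi|^2$, and the $i_j$ line field is specified by $\xi i_j\xi^*$. \end{itemize}
   Context: **Clifford algebra.** $\mathcal{C}\ell_{0,n}$ is the real unital associative algebra generated by $i_1,\dots,i_n$ with $i_j^2=-1$ and $i_ji_k=-i_ki_j$ for $j\ne k$. For $x\in\mathcal{C}\ell_{0,n}$: $x'$ is the image of $x$ under the algebra automorphism with $i_j\mapsto -i_j$; $x^*$ is its image under the algebra antiautomorphism fixing each $i_j$ (reversal); $\overline{x}=(x')^*$. $\mathrm{Re}(x)$ is the coefficient of $1$ in the monomial basis, and $N(x)=|x|^2=\mathrm{Re}(x\overline{x})$. Paravectors: $\$\mathbb{R}^{n+1}=\mathbb{R}\oplus\mathrm{span}(i_1,\dots,i_n)$, with inner product $\mathbf{V}\cdot\mathbf{W}=\mathrm{Re}(\mathbf{V}\overline{\mathbf{W}})$. $\$\Gamma_{n+1}$ is the group generated under multiplication by the non-zero paravectors,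 and $\$\Gamma_{n+1}^{\triangleright}=\$\Gamma_{n+1}\cup\{0\}$. **Spinors.** $S\$\Gamma_{n+1}$ is the set of column pairs $\kappa=(\xi,\eta)$ with $\xi,\eta\in\$\Gamma_{n+1}^{\triangleright}$, not both zero, and $\xi\overline{\eta}\in\$\mathbb{R}^{n+1}$. Write $v^{\dagger}=(\overline{x},\overline{y})$ (a row) for a column $v=(x,y)\in\mathcal{C}\ell_{0,n}^2$, $(x,y)a=(xa,ya)$, and $\check{\kappa}=(\eta',-\xi')$. **Minkowski space.** $\mathbb{R}^{1,n+2}$ has coordinates $(T,Z;\mathbf{X})$, $T,Z\in\mathbb{R}$, $\mathbf{X}=X_0+\sum_jX_ji_j\in\$\mathbb{R}^{n+1}$, and bilinear form $(\cdot|\cdot)_{1,n+2}$ with quadratic form $T^2-Z^2-|\mathbf{X}|^2$. It is identified with the matrices $\frac12\begin{pmatrix}T+Z&\mathbf{X}\\ \overline{\mathbf{X}}&T-Z\end{pmatrix}$. $L^+$ is the set of non-zero null vectors with $T>0$. The map $\phi_1:S\$\Gamma_{n+1}\to L^+$ is $\phi_1(\kappa)=\kappa\kappa^{\dagger}$, with derivative $(D_\kappa\phi_1)(v)=\kappa v^{\dagger}+v\kappa^{\dagger}$. **Flags.** For $p\in L^+$ and $v\in T_pL^+=p^\perp$ linearly independent of $p$, $[[p,v]]$ is the null flag $0\subset\mathbb{R}p\subset F_{p,v}=\mathrm{span}(p,v)$ based at $p$, with $F_{p,v}/\mathbb{R}p$ oriented by the class of $v$. The multiflag $[[p;v_1,\dots,v_n]]$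 is the ordered tuple $([[p,v_1]],\dots,[[p,v_n]])$. Put $\Phi_1(\kappa)=[[\phi_1(\kappa);(D_\kappa\phi_1)(\check\kappa i_1),\dots,(D_\kappa\phi_1)(\check\kappa i_n)]]$. **Horospheres.** Hyperbolic space is the hyperboloid $\mathbb{H}^{n+2}=\{x\in\mathbb{R}^{1,n+2}:(x|x)_{1,n+2}=1,\ T>0\}$. For $p\in L^+$, $\phi_2(p)$ is the horosphere $\{x\in\mathbb{H}^{n+2}:(x|p)_{1,n+2}=1\}$. $\Phi_2([[p;v_1,\dots,v_n]])$ is the horosphere $\phi_2(p)$ together with the $n$ oriented line fields whose $j$-th one (the $i_j$ line field) at $q\in\phi_2(p)$ is the line $T_q\phi_2(p)\cap F_{p,v_j}$, oriented so that the projection $F_{p,v_j}\to F_{p,v_j}/\mathbb{R}p$ is orientation preserving on it. $\Phi=\Phi_2\circ\Phi_1$. A line field on a horosphere is parallel if it is parallel in the Euclidean geometry of the horosphere, i.e. invariant under all parabolic translations fixing the horosphere. **Upper half-space.** $\mathbb{U}^{n+2}=\{(z;\mathbf{x}):z>0,\ \mathbf{x}\in\$\mathbb{R}^{n+1}\}$ with metric $(dz^2+|d\mathbf{x}|^2)/z^2$ and ideal boundary $\$\mathbb{R}^{n+1}\cup\{\infty\}$. The hyperboloid is identified with $\mathbb{U}^{n+2}$ by the isometry $\pi(T,Z;\mathbf{X})=\left(\frac{1}{T-Z};\frac{\mathbf{X}}{T-Z}\right)$ (the composite of the projection $(T,Z;\mathbf{X})\mapsto\frac{1}{1+T}(Z;\mathbf{X})$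 to the ball model and $(w;\mathbf{y})\mapsto\frac{(1-w^2-|\mathbf{y}|^2;\,2\mathbf{y})}{(1-w)^2+|\mathbf{y}|^2}$); on the boundary the ray of $(T,Z;\mathbf{X})\in L^+$ goes to $\mathbf{X}/(T-Z)$ ($\infty$ if $T=Z$). Horospheres centred at $\infty$ are the planes $z=\text{const}$, and this constant is the Euclidean height; other horospheres are Euclidean spheres tangent to the boundary at their centre, and the Euclidean diameter is the maximal value of $z$, attained at the north pole. A paravector $\mathbf{D}\neq 0$ specifies a parallel oriented line field on a horosphere centred at $\infty$ if the field is everywhere in the direction of the horizontal tangent vector $\mathbf{D}$; it is a north pole specification of a parallel oriented line field on a horosphere with finite centre if at the north pole the field has the direction of the horizontal tangent vector $\mathbf{D}$ (only the direction of $\mathbf{D}$ matters). *)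

theory Defs
  imports "HOL-Analysis.Analysis"
begin

section \<open>Clifford algebras\<close>

text \<open>
  All algebras \<open>Cl(0,n)\<close> are realised inside one type, with generators \<open>i\<^sub>1, i\<^sub>2, \<dots>\<close>. An element is
  given by its finitely many coefficients in the monomial basis \<open>e\<^sub>A = i\<^sub>a\<^sub>1 \<dots> i\<^sub>a\<^sub>k\<close> with
  \<open>A = {a\<^sub>1 < \<dots> < a\<^sub>k}\<close>; \<open>Cl(0,n)\<close> is the span of the \<open>e\<^sub>A\<close> with \<open>A \<subseteq> {1..n}\<close>.
\<close>

typedef clifford =
  "{f :: nat set \<Rightarrow> real. finite {A. f A \<noteq> 0} \<and> (\<forall>A. f A \<noteq> 0 \<longrightarrow> finite A)}"
  morphisms mcoeff Abs_clifford
  by (rule exI[of _ "\<lambda>_. 0"]) simp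

setup_lifting type_definition_clifford

lemma clifford_eqI: "(\<And>A. mcoeff x A = mcoeff y A) \<Longrightarrow> x = y"
  by transfer auto

lemma finite_supp [simp]: "finite {A. mcoeff x A \<noteq> 0}"
  by transfer auto

lemma finite_index: "mcoeff x A \<noteq> 0 \<Longrightarrow> finite A"
  by transfer auto

lemma mcoeff_infinite [simp]: "infinite A \<Longrightarrow> mcoeff x A = 0"
  using finite_index by blast

text \<open>
  \<open>e\<^sub>A e\<^sub>B = msign A B \<cdot> e\<^sub>C\<close> with \<open>C\<close> the symmetric difference of \<open>A\<close> and \<open>B\<close>: one sign for each
  transposition of generators \<open>a > b\<close>, and one for each square \<open>i\<^sub>a\<^sup>2 = -1\<close>.
\<close>

definition msign :: "nat set \<Rightarrow> nat set \<Rightarrow> real" where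
  "msign A B = (\<Prod>a\<in>A. \<Prod>b\<in>B. if b \<le> a then -1 else 1)"

lemma prod_sym_diff_sign:
  fixes f :: "'a \<Rightarrow> real"
  assumes "finite A" "finite B" "\<And>a. f a * f a = 1"
  shows "prod f (sym_diff A B) = prod f A * prod f B"
proof -
  have sq: "prod f C * prod f C = 1" for C
    by (simp add: assms(3) flip: prod.distrib)
  have "prod f A = prod f (A - B) * prod f (A \<inter> B)"
    by (metis Int_Diff_disjoint Int_Diff_Un assms(1) finite_Diff finite_Int inf_commute
        prod.union_disjoint sup_commute)
  moreover have "prod f B = prod f (B - A) * prod f (A \<inter> B)"
    by (metis Int_Diff_disjoint Int_Diff_Un assms(2) finite_Diff finite_Int inf_commute
        prod.union_disjoint sup_commute)
  moreover have "prod f (sym_diff A B) = prod f (A - B) * prod f (B - A)"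
    by (rule prod.union_disjoint) (use assms in auto)
  ultimately show ?thesis using sq[of "A \<inter> B"]
    by (simp add: algebra_simps)
qed

lemma msign_sq [simp]: "msign A B * msign A B = 1"
  unfolding msign_def by (auto simp flip: prod.distrib intro!: prod.neutral)

lemma msign_empty [simp]: "msign {} B = 1" "msign A {} = 1"
  by (simp_all add: msign_def)

lemma msign_sym_diff_left:
  "finite A \<Longrightarrow> finite B \<Longrightarrow> msign (sym_diff A B) C = msign A C * msign B C"
  unfolding msign_def by (rule prod_sym_diff_sign) (auto simp flip: prod.distrib intro!: prod.neutral)

lemma msign_sym_diff_right:
  "finite B \<Longrightarrow> finite C \<Longrightarrow> msign A (sym_diff B C) = msign A B * msign A C"
  unfolding msign_def
  by (subst prod_sym_diff_sign) (auto simp flip: prod.distrib)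

instantiation clifford :: real_vector
begin

lift_definition zero_clifford :: clifford is "\<lambda>_. 0" by simp

lift_definition plus_clifford :: "clifford \<Rightarrow> clifford \<Rightarrow> clifford" is "\<lambda>f g A. f A + g A"
  subgoal for f g
    by (auto intro: rev_finite_subset[of "{A. f A \<noteq> 0} \<union> {A. g A \<noteq> 0}"])
       (metis add.left_neutral)
  done

lift_definition uminus_clifford :: "clifford \<Rightarrow> clifford" is "\<lambda>f A. - f A" by simp

lift_definition minus_clifford :: "clifford \<Rightarrow> clifford \<Rightarrow> clifford" is "\<lambda>f g A. f A - g A"
  subgoal for f g
    by (auto intro: rev_finite_subset[of "{A. f A \<noteq> 0} \<union> {A. g A \<noteq> 0}"])
       metis
  done

lift_definition scaleR_clifford :: "real \<Rightarrow> clifford \<Rightarrow> clifford" is "\<lambda>c f A. c * f A"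
  subgoal for c f
    by (auto intro: rev_finite_subset[of "{A. f A \<noteq> 0}"])
  done

instance
  by standard (transfer; auto simp: fun_eq_iff algebra_simps)+

end

lemma mcoeff_simps [simp]:
  "mcoeff 0 A = 0"
  "mcoeff (x + y) A = mcoeff x A + mcoeff y A"
  "mcoeff (x - y) A = mcoeff x A - mcoeff y A"
  "mcoeff (- x) A = - mcoeff x A"
  "mcoeff (c *\<^sub>R x) A = c * mcoeff x A"
  by (transfer, simp)+

lemma sum_if_pull':
  "(if P then a * (\<Sum>A\<in>V. \<Sum>B\<in>W. if Q A B then f A B else 0) else 0)
    = (\<Sum>A\<in>V. \<Sum>B\<in>W. if Q A B then (if P then a * f A B else (0::real)) else 0)"
  by (cases P) (auto simp: sum_distrib_left intro!: sum.cong sum.neutral)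

lemma sum_if_pull:
  "(if P then a * (\<Sum>A\<in>V. \<Sum>B\<in>W. if Q A B then f A B else 0) * c else 0)
    = (\<Sum>A\<in>V. \<Sum>B\<in>W. if Q A B then (if P then a * f A B * c else (0::real)) else 0)"
  by (cases P) (auto simp: sum_distrib_left sum_distrib_right intro!: sum.cong sum.neutral)

lemma sum_rotate:
  "(\<Sum>a\<in>U. \<Sum>b\<in>V. \<Sum>c\<in>W. f a b c) = (\<Sum>b\<in>V. \<Sum>c\<in>W. \<Sum>a\<in>U. (f a b c :: real))"
  by (subst sum.swap) (rule sum.cong[OF refl], rule sum.swap)

lemma exists_frame:
  "\<exists>V. finite V \<and> (\<forall>A. mcoeff x A \<noteq> 0 \<longrightarrow> A \<subseteq> V)"
  by (rule exI[of _ "\<Union>{A. mcoeff x A \<noteq> 0}"]) (auto intro: finite_index)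

instantiation clifford :: real_algebra_1
begin

lift_definition one_clifford :: clifford is "\<lambda>A. if A = {} then 1 else 0" by simp

lift_definition times_clifford :: "clifford \<Rightarrow> clifford \<Rightarrow> clifford" is
  "\<lambda>f g C. \<Sum>A | f A \<noteq> 0. \<Sum>B | g B \<noteq> 0.
     if sym_diff A B = C then msign A B * f A * g B else 0"
proof -
  fix f g :: "nat set \<Rightarrow> real"
  assume f: "finite {A. f A \<noteq> 0} \<and> (\<forall>A. f A \<noteq> 0 \<longrightarrow> finite A)"
    and g: "finite {A. g A \<noteq> 0} \<and> (\<forall>A. g A \<noteq> 0 \<longrightarrow> finite A)"
  let ?h = "\<lambda>C. \<Sum>A | f A \<noteq> 0. \<Sum>B | g B \<noteq> 0.
     if sym_diff A B = C then msign A B * f A * g B else 0"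
  let ?I = "(\<lambda>(A, B). sym_diff A B) ` ({A. f A \<noteq> 0} \<times> {B. g B \<noteq> 0})"
  have *: "C \<in> ?I" if nz: "?h C \<noteq> 0" for C
  proof (rule ccontr)
    assume "C \<notin> ?I"
    hence "\<And>A B. f A \<noteq> 0 \<Longrightarrow> g B \<noteq> 0 \<Longrightarrow> sym_diff A B \<noteq> C" by force
    hence "?h C = 0" by (intro sum.neutral ballI) auto
    thus False using nz by contradiction
  qed
  have "finite {C. ?h C \<noteq> 0}"
    by (rule finite_subset[of _ ?I]) (use * f g in auto)
  moreover have "finite C" if nz: "?h C \<noteq> 0" for C
    using *[OF nz] f g by auto
  ultimately show "finite {C. ?h C \<noteq> 0} \<and> (\<forall>C. ?h C \<noteq> 0 \<longrightarrow> finite C)" by blast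
qed

lemma mcoeff_one: "mcoeff 1 A = (if A = {} then 1 else 0)"
  by transfer simp

lemma mcoeff_times:
  assumes V: "finite V" "\<forall>A. mcoeff x A \<noteq> 0 \<longrightarrow> A \<subseteq> V" "\<forall>A. mcoeff y A \<noteq> 0 \<longrightarrow> A \<subseteq> V"
  shows "mcoeff (x * y) C = (\<Sum>A\<in>Pow V. \<Sum>B\<in>Pow V.
     if sym_diff A B = C then msign A B * mcoeff x A * mcoeff y B else 0)"
proof -
  have "mcoeff (x * y) C = (\<Sum>A | mcoeff x A \<noteq> 0. \<Sum>B | mcoeff y B \<noteq> 0.
     if sym_diff A B = C then msign A B * mcoeff x A * mcoeff y B else 0)"
    by transfer simp
  also have "\<dots> = (\<Sum>A | mcoeff x A \<noteq> 0. \<Sum>B\<in>Pow V.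
     if sym_diff A B = C then msign A B * mcoeff x A * mcoeff y B else 0)"
    by (intro sum.cong refl sum.mono_neutral_left) (use V in \<open>auto intro!: sum.neutral\<close>)
  also have "\<dots> = (\<Sum>A\<in>Pow V. \<Sum>B\<in>Pow V.
     if sym_diff A B = C then msign A B * mcoeff x A * mcoeff y B else 0)"
    by (intro sum.mono_neutral_left) (use V in \<open>auto intro!: sum.neutral split: if_splits\<close>)
  finally show ?thesis .
qed

lemma times_frame:
  assumes V: "finite V" "\<forall>A. mcoeff x A \<noteq> 0 \<longrightarrow> A \<subseteq> V" "\<forall>A. mcoeff y A \<noteq> 0 \<longrightarrow> A \<subseteq> V"
    and "mcoeff (x * y) C \<noteq> 0"
  shows "C \<subseteq> V"
proof (rule ccontr)
  assume "\<not> C \<subseteq> V"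
  hence "\<And>A B. A \<subseteq> V \<Longrightarrow> B \<subseteq> V \<Longrightarrow> sym_diff A B \<noteq> C" by blast
  hence "mcoeff (x * y) C = 0"
    by (subst mcoeff_times[OF V]) (auto intro!: sum.neutral)
  thus False using assms(4) by contradiction
qed

instance
proof
  fix x y z :: clifford and c :: real
  obtain V where V: "finite V" and
      x: "\<forall>A. mcoeff x A \<noteq> 0 \<longrightarrow> A \<subseteq> V" and y: "\<forall>A. mcoeff y A \<noteq> 0 \<longrightarrow> A \<subseteq> V" and
      z: "\<forall>A. mcoeff z A \<noteq> 0 \<longrightarrow> A \<subseteq> V"
  proof -
    obtain V1 V2 V3 where
      "finite V1 \<and> (\<forall>A. mcoeff x A \<noteq> 0 \<longrightarrow> A \<subseteq> V1)"
      "finite V2 \<and> (\<forall>A. mcoeff y A \<noteq> 0 \<longrightarrow> A \<subseteq> V2)"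
      "finite V3 \<and> (\<forall>A. mcoeff z A \<noteq> 0 \<longrightarrow> A \<subseteq> V3)"
      using exists_frame by metis
    thus thesis by (intro that[of "V1 \<union> V2 \<union> V3"]) blast+
  qed
  have fin: "finite A" if "A \<in> Pow V" for A using that V finite_subset by blast
  have sdV: "sym_diff A B \<in> Pow V" if "A \<in> Pow V" "B \<in> Pow V" for A B using that by blast
  have xy: "\<forall>A. mcoeff (x * y) A \<noteq> 0 \<longrightarrow> A \<subseteq> V"
    and yz: "\<forall>A. mcoeff (y * z) A \<noteq> 0 \<longrightarrow> A \<subseteq> V"
    using times_frame[OF V x y] times_frame[OF V y z] by auto
  have xy': "\<forall>A. mcoeff (x + y) A \<noteq> 0 \<longrightarrow> A \<subseteq> V"
    using x y by (metis add.left_neutral mcoeff_simps(2))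
  have yz': "\<forall>A. mcoeff (y + z) A \<noteq> 0 \<longrightarrow> A \<subseteq> V"
    using y z by (metis add.left_neutral mcoeff_simps(2))
  have one: "\<forall>A. mcoeff 1 A \<noteq> 0 \<longrightarrow> A \<subseteq> V"
    by (simp add: mcoeff_one split: if_splits)
  have cx: "\<forall>A. mcoeff (c *\<^sub>R x) A \<noteq> 0 \<longrightarrow> A \<subseteq> V"
    and cy: "\<forall>A. mcoeff (c *\<^sub>R y) A \<noteq> 0 \<longrightarrow> A \<subseteq> V"
    using x y by auto
  show "x * y * z = x * (y * z)"
  proof (rule clifford_eqI)
    fix D
    have "mcoeff (x * y * z) D = (\<Sum>E\<in>Pow V. \<Sum>C\<in>Pow V. if sym_diff E C = D then msign E C *
        (\<Sum>A\<in>Pow V. \<Sum>B\<in>Pow V. if sym_diff A B = E then msign A B * mcoeff x A * mcoeff y B else 0)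
          * mcoeff z C else 0)"
      by (simp only: mcoeff_times[OF V xy z] mcoeff_times[OF V x y])
    also have "\<dots> = (\<Sum>E\<in>Pow V. \<Sum>C\<in>Pow V. \<Sum>A\<in>Pow V. \<Sum>B\<in>Pow V. if sym_diff A B = E then
        (if sym_diff E C = D then msign E C * msign A B * mcoeff x A * mcoeff y B * mcoeff z C else 0)
          else 0)"
      unfolding sum_if_pull by (simp only: mult_ac)
    also have "\<dots> = (\<Sum>A\<in>Pow V. \<Sum>B\<in>Pow V. \<Sum>C\<in>Pow V. \<Sum>E\<in>Pow V. if sym_diff A B = E then
        (if sym_diff E C = D then msign E C * msign A B * mcoeff x A * mcoeff y B * mcoeff z C else 0)
          else 0)"
      by (subst (2) sum.swap, subst (3) sum.swap, subst (1) sum.swap, subst (2) sum.swap,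
          subst (3) sum.swap) (rule refl)
    also have "\<dots> = (\<Sum>A\<in>Pow V. \<Sum>B\<in>Pow V. \<Sum>C\<in>Pow V.
        if sym_diff (sym_diff A B) C = D then
          msign (sym_diff A B) C * msign A B * mcoeff x A * mcoeff y B * mcoeff z C else 0)"
      using V sdV by (intro sum.cong refl) simp
    finally have l: "mcoeff (x * y * z) D = \<dots>" .
    have "mcoeff (x * (y * z)) D = (\<Sum>A\<in>Pow V. \<Sum>E\<in>Pow V. if sym_diff A E = D then msign A E *
        mcoeff x A * (\<Sum>B\<in>Pow V. \<Sum>C\<in>Pow V.
          if sym_diff B C = E then msign B C * mcoeff y B * mcoeff z C else 0) else 0)"
      by (simp only: mcoeff_times[OF V x yz] mcoeff_times[OF V y z])
    also have "\<dots> = (\<Sum>A\<in>Pow V. \<Sum>E\<in>Pow V. \<Sum>B\<in>Pow V. \<Sum>C\<in>Pow V. if sym_diff B C = E then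
        (if sym_diff A E = D then msign A E * msign B C * mcoeff x A * mcoeff y B * mcoeff z C else 0)
          else 0)"
      unfolding sum_if_pull' by (simp only: mult_ac)
    also have "\<dots> = (\<Sum>A\<in>Pow V. \<Sum>B\<in>Pow V. \<Sum>C\<in>Pow V. \<Sum>E\<in>Pow V. if sym_diff B C = E then
        (if sym_diff A E = D then msign A E * msign B C * mcoeff x A * mcoeff y B * mcoeff z C else 0)
          else 0)"
      by (rule sum.cong[OF refl], rule sum_rotate)
    also have "\<dots> = (\<Sum>A\<in>Pow V. \<Sum>B\<in>Pow V. \<Sum>C\<in>Pow V.
        if sym_diff A (sym_diff B C) = D then
          msign A (sym_diff B C) * msign B C * mcoeff x A * mcoeff y B * mcoeff z C else 0)"
      using V sdV by (intro sum.cong refl) simp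
    also have "\<dots> = (\<Sum>A\<in>Pow V. \<Sum>B\<in>Pow V. \<Sum>C\<in>Pow V.
        if sym_diff (sym_diff A B) C = D then
          msign (sym_diff A B) C * msign A B * mcoeff x A * mcoeff y B * mcoeff z C else 0)"
    proof (intro sum.cong refl)
      fix A B C assume "A \<in> Pow V" "B \<in> Pow V" "C \<in> Pow V"
      hence f: "finite A" "finite B" "finite C" using fin by auto
      have e: "sym_diff A (sym_diff B C) = sym_diff (sym_diff A B) C" by blast
      have s: "msign A (sym_diff B C) * msign B C = msign (sym_diff A B) C * msign A B"
        unfolding msign_sym_diff_left[OF f(1,2)] msign_sym_diff_right[OF f(2,3)]
        by (simp add: mult_ac)
      show "(if sym_diff A (sym_diff B C) = D then
          msign A (sym_diff B C) * msign B C * mcoeff x A * mcoeff y B * mcoeff z C else 0)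
        = (if sym_diff (sym_diff A B) C = D then
          msign (sym_diff A B) C * msign A B * mcoeff x A * mcoeff y B * mcoeff z C else 0)"
        unfolding e s ..
    qed
    finally show "mcoeff (x * y * z) D = mcoeff (x * (y * z)) D" using l by simp
  qed
  show "(x + y) * z = x * z + y * z"
    by (rule clifford_eqI)
      (simp only: mcoeff_simps mcoeff_times[OF V xy' z] mcoeff_times[OF V x z]
         mcoeff_times[OF V y z] flip: sum.distrib,
       intro sum.cong refl, simp add: algebra_simps)
  show "x * (y + z) = x * y + x * z"
    by (rule clifford_eqI)
      (simp only: mcoeff_simps mcoeff_times[OF V x yz'] mcoeff_times[OF V x y]
         mcoeff_times[OF V x z] flip: sum.distrib,
       intro sum.cong refl, simp add: algebra_simps)
  show "c *\<^sub>R x * y = c *\<^sub>R (x * y)"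
    by (rule clifford_eqI)
      (simp only: mcoeff_simps mcoeff_times[OF V cx y] mcoeff_times[OF V x y] sum_distrib_left,
       intro sum.cong refl, simp add: algebra_simps)
  show "x * c *\<^sub>R y = c *\<^sub>R (x * y)"
    by (rule clifford_eqI)
      (simp only: mcoeff_simps mcoeff_times[OF V x cy] mcoeff_times[OF V x y] sum_distrib_left,
       intro sum.cong refl, simp add: algebra_simps)
  show "1 * x = x"
  proof (rule clifford_eqI)
    fix C
    have "mcoeff (1 * x) C = (\<Sum>A\<in>Pow V. if A = {} then mcoeff x C else 0)"
      unfolding mcoeff_times[OF V one x]
    proof (intro sum.cong refl)
      fix A assume "A \<in> Pow V"
      show "(\<Sum>B\<in>Pow V. if sym_diff A B = C then msign A B * mcoeff 1 A * mcoeff x B else 0)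
        = (if A = {} then mcoeff x C else 0)"
      proof (cases "A = {}")
        case True
        thus ?thesis using V x by (auto simp: mcoeff_one)
      next
        case False
        hence "mcoeff 1 A = 0" by (simp add: mcoeff_one)
        thus ?thesis using False by (simp cong: if_cong)
      qed
    qed
    thus "mcoeff (1 * x) C = mcoeff x C" using V by simp
  qed
  show "x * 1 = x"
  proof (rule clifford_eqI)
    fix C
    have "mcoeff (x * 1) C = (\<Sum>A\<in>Pow V. if A = C then mcoeff x C else 0)"
      unfolding mcoeff_times[OF V x one]
    proof (intro sum.cong refl)
      fix A assume A: "A \<in> Pow V"
      have "(\<Sum>B\<in>Pow V. if sym_diff A B = C then msign A B * mcoeff x A * mcoeff 1 B else 0)
        = (\<Sum>B\<in>Pow V. if B = {} then (if A = C then mcoeff x A else 0) else 0)"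
        by (intro sum.cong refl) (auto simp: mcoeff_one)
      thus "(\<Sum>B\<in>Pow V. if sym_diff A B = C then msign A B * mcoeff x A * mcoeff 1 B else 0)
        = (if A = C then mcoeff x C else 0)" using V by auto
    qed
    thus "mcoeff (x * 1) C = mcoeff x C" using V x by auto
  qed
  show "(0::clifford) \<noteq> 1"
    by (metis mcoeff_one mcoeff_simps(1) zero_neq_one)
qed

end

lemma uminus_one_power_sq [simp]: "(-1::real) ^ k * (-1) ^ k = 1"
  by (simp flip: power_mult_distrib)

instantiation clifford :: real_inner
begin

definition inner_clifford :: "clifford \<Rightarrow> clifford \<Rightarrow> real" where
  "inner_clifford x y = (\<Sum>A | mcoeff x A \<noteq> 0. mcoeff x A * mcoeff y A)"

definition norm_clifford :: "clifford \<Rightarrow> real" where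
  "norm_clifford x = sqrt (inner x x)"

definition sgn_clifford :: "clifford \<Rightarrow> clifford" where
  "sgn_clifford x = x /\<^sub>R norm x"

definition dist_clifford :: "clifford \<Rightarrow> clifford \<Rightarrow> real" where
  "dist_clifford x y = norm (x - y)"

definition uniformity_clifford :: "(clifford \<times> clifford) filter" where
  "uniformity_clifford = (INF e\<in>{0<..}. principal {(x, y). dist x y < e})"

definition open_clifford :: "clifford set \<Rightarrow> bool" where
  "open_clifford U \<longleftrightarrow> (\<forall>x\<in>U. eventually (\<lambda>(x', y). x' = x \<longrightarrow> y \<in> U) uniformity)"

lemma inner_frame:
  assumes "finite V" "\<forall>A. mcoeff x A \<noteq> 0 \<longrightarrow> A \<subseteq> V"
  shows "inner x y = (\<Sum>A\<in>Pow V. mcoeff x A * mcoeff y A)"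
  unfolding inner_clifford_def
  by (rule sum.mono_neutral_left) (use assms in auto)

instance
proof
  fix x y z :: clifford and r :: real and U :: "clifford set"
  obtain V where V: "finite V" and
      x: "\<forall>A. mcoeff x A \<noteq> 0 \<longrightarrow> A \<subseteq> V" and y: "\<forall>A. mcoeff y A \<noteq> 0 \<longrightarrow> A \<subseteq> V"
  proof -
    obtain V1 V2 where
      "finite V1 \<and> (\<forall>A. mcoeff x A \<noteq> 0 \<longrightarrow> A \<subseteq> V1)"
      "finite V2 \<and> (\<forall>A. mcoeff y A \<noteq> 0 \<longrightarrow> A \<subseteq> V2)"
      using exists_frame by metis
    thus thesis by (intro that[of "V1 \<union> V2"]) blast+
  qed
  have xy: "\<forall>A. mcoeff (x + y) A \<noteq> 0 \<longrightarrow> A \<subseteq> V"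
    using x y by (metis add.left_neutral mcoeff_simps(2))
  have rx: "\<forall>A. mcoeff (r *\<^sub>R x) A \<noteq> 0 \<longrightarrow> A \<subseteq> V"
    using x by auto
  show "dist x y = norm (x - y)" by (rule dist_clifford_def)
  show "sgn x = x /\<^sub>R norm x" by (rule sgn_clifford_def)
  show "uniformity = (INF e\<in>{0<..}. principal {(x, y). dist (x::clifford) y < e})"
    by (rule uniformity_clifford_def)
  show "open U = (\<forall>x\<in>U. eventually (\<lambda>(x', y). x' = x \<longrightarrow> y \<in> U) uniformity)"
    by (rule open_clifford_def)
  show "inner x y = inner y x"
    unfolding inner_frame[OF V x] inner_frame[OF V y] by (simp add: mult.commute)
  show "inner (x + y) z = inner x z + inner y z"
    unfolding inner_frame[OF V x] inner_frame[OF V y] inner_frame[OF V xy]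
    by (simp add: algebra_simps sum.distrib)
  show "inner (r *\<^sub>R x) y = r * inner x y"
    unfolding inner_frame[OF V x] inner_frame[OF V rx]
    by (simp add: sum_distrib_left mult.assoc)
  show "0 \<le> inner x x"
    unfolding inner_clifford_def by (rule sum_nonneg) simp
  show "inner x x = 0 \<longleftrightarrow> x = 0"
  proof
    assume "inner x x = 0"
    hence "\<forall>A\<in>{A. mcoeff x A \<noteq> 0}. mcoeff x A * mcoeff x A = 0"
      unfolding inner_clifford_def by (subst (asm) sum_nonneg_eq_0_iff) auto
    thus "x = 0" by (intro clifford_eqI) auto
  qed (simp add: inner_clifford_def)
  show "norm x = sqrt (inner x x)" by (rule norm_clifford_def)
qed

end

lift_definition blade :: "nat set \<Rightarrow> clifford" is "\<lambda>A B. if finite A \<and> B = A then 1 else 0"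
  by simp

definition gen :: "nat \<Rightarrow> clifford" where
  "gen j = blade {j}"

definition scalar_part :: "clifford \<Rightarrow> real" where
  "scalar_part x = mcoeff x {}"

text \<open>
  The automorphism with \<open>i\<^sub>j \<mapsto> -i\<^sub>j\<close> and the antiautomorphism fixing every \<open>i\<^sub>j\<close>, by their effect on
  \<open>e\<^sub>A\<close>; the lemmas below show that they have these defining properties.
\<close>

lift_definition grade_inv :: "clifford \<Rightarrow> clifford" is "\<lambda>f A. (-1) ^ card A * f A"
  by simp

lift_definition reversal :: "clifford \<Rightarrow> clifford" is
  "\<lambda>f A. (-1) ^ (card A * (card A - 1) div 2) * f A"
  by simp

definition cconj :: "clifford \<Rightarrow> clifford" where
  "cconj x = reversal (grade_inv x)"

definition cnorm_sq :: "clifford \<Rightarrow> real" where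
  "cnorm_sq x = scalar_part (x * cconj x)"

definition cinv :: "clifford \<Rightarrow> clifford" where
  "cinv x = (THE y. x * y = 1 \<and> y * x = 1)"

lemma mcoeff_blade: "mcoeff (blade A) B = (if finite A \<and> B = A then 1 else 0)"
  by transfer simp

lemma mcoeff_grade_inv: "mcoeff (grade_inv x) A = (-1) ^ card A * mcoeff x A"
  by transfer simp

lemma mcoeff_reversal:
  "mcoeff (reversal x) A = (-1) ^ (card A * (card A - 1) div 2) * mcoeff x A"
  by transfer simp

lemma msign_self:
  "finite A \<Longrightarrow> msign A A = (-1) ^ (card A * (card A - 1) div 2) * (-1) ^ card A"
proof (induction A rule: finite_linorder_max_induct)
  case (insert m A)
  have "msign (insert m A) (insert m A)
      = (\<Prod>b\<in>insert m A. if b \<le> m then -1 else 1) * (\<Prod>a\<in>A. \<Prod>b\<in>insert m A. if b \<le> a then -1 else 1)"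
    unfolding msign_def using insert by (subst prod.insert) auto
  also have "(\<Prod>b\<in>insert m A. if b \<le> m then -1 else (1::real)) = (\<Prod>b\<in>insert m A. -1)"
    using insert by (intro prod.cong) auto
  also have "\<dots> = (-1) ^ Suc (card A)"
    using insert by (subst prod_constant, subst card_insert_disjoint) auto
  also have "(\<Prod>a\<in>A. \<Prod>b\<in>insert m A. if b \<le> a then -1 else 1) = msign A A"
    unfolding msign_def using insert by (intro prod.cong[OF refl], subst prod.insert) auto
  finally have 1: "msign (insert m A) (insert m A) = (-1) ^ Suc (card A) * msign A A" .
  have c: "card (insert m A) = Suc (card A)"
    using insert by (intro card_insert_disjoint) auto
  have 2: "Suc k * (Suc k - 1) div 2 = k + k * (k - 1) div 2" for k :: nat
    by (cases k) (auto simp: algebra_simps)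
  show ?case unfolding 1 c 2 insert.IH by (simp add: power_add)
qed simp

lemma mcoeff_cconj: "mcoeff (cconj x) A = msign A A * mcoeff x A"
  by (cases "finite A") (simp_all add: cconj_def mcoeff_reversal mcoeff_grade_inv msign_self)

lemma neg_one_power_sym_diff:
  "finite A \<Longrightarrow> finite B \<Longrightarrow> (-1::real) ^ card (sym_diff A B) = (-1) ^ card A * (-1) ^ card B"
  using prod_sym_diff_sign[of A B "\<lambda>_. -1"] by simp

lemma exists_frame2:
  "\<exists>V. finite V \<and> (\<forall>A. mcoeff x A \<noteq> 0 \<longrightarrow> A \<subseteq> V) \<and> (\<forall>A. mcoeff y A \<noteq> 0 \<longrightarrow> A \<subseteq> V)"
proof -
  obtain V1 V2 where
    "finite V1 \<and> (\<forall>A. mcoeff x A \<noteq> 0 \<longrightarrow> A \<subseteq> V1)"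
    "finite V2 \<and> (\<forall>A. mcoeff y A \<noteq> 0 \<longrightarrow> A \<subseteq> V2)"
    using exists_frame by metis
  thus ?thesis by (intro exI[of _ "V1 \<union> V2"]) blast
qed

lemma grade_inv_one [simp]: "grade_inv 1 = 1"
  by (rule clifford_eqI) (simp add: mcoeff_grade_inv mcoeff_one)

lemma grade_inv_add: "grade_inv (x + y) = grade_inv x + grade_inv y"
  by (rule clifford_eqI) (simp add: mcoeff_grade_inv algebra_simps)

lemma grade_inv_scaleR: "grade_inv (c *\<^sub>R x) = c *\<^sub>R grade_inv x"
  by (rule clifford_eqI) (simp add: mcoeff_grade_inv)

lemma grade_inv_gen [simp]: "grade_inv (gen j) = - gen j"
  by (rule clifford_eqI) (simp add: mcoeff_grade_inv gen_def mcoeff_blade)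

lemma grade_inv_mult: "grade_inv (x * y) = grade_inv x * grade_inv y"
proof (rule clifford_eqI)
  fix C
  obtain V where V: "finite V" and
      x: "\<forall>A. mcoeff x A \<noteq> 0 \<longrightarrow> A \<subseteq> V" and y: "\<forall>A. mcoeff y A \<noteq> 0 \<longrightarrow> A \<subseteq> V"
    using exists_frame2 by metis
  have x': "\<forall>A. mcoeff (grade_inv x) A \<noteq> 0 \<longrightarrow> A \<subseteq> V"
    and y': "\<forall>A. mcoeff (grade_inv y) A \<noteq> 0 \<longrightarrow> A \<subseteq> V"
    using x y by (simp_all add: mcoeff_grade_inv)
  show "mcoeff (grade_inv (x * y)) C = mcoeff (grade_inv x * grade_inv y) C"
    unfolding mcoeff_grade_inv[of "x * y"] mcoeff_times[OF V x y] mcoeff_times[OF V x' y']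
      sum_distrib_left
  proof (intro sum.cong refl)
    fix A B assume "A \<in> Pow V" "B \<in> Pow V"
    hence f: "finite A" "finite B" using V finite_subset by auto
    show "(-1) ^ card C * (if sym_diff A B = C then msign A B * mcoeff x A * mcoeff y B else 0)
      = (if sym_diff A B = C then msign A B * mcoeff (grade_inv x) A * mcoeff (grade_inv y) B else 0)"
      by (cases "sym_diff A B = C")
        (simp only: if_True neg_one_power_sym_diff[OF f, symmetric] mcoeff_grade_inv,
         use neg_one_power_sym_diff[OF f] in auto)
  qed
qed

lemma reversal_one [simp]: "reversal 1 = 1"
  by (rule clifford_eqI) (simp add: mcoeff_reversal mcoeff_one)

lemma reversal_add: "reversal (x + y) = reversal x + reversal y"
  by (rule clifford_eqI) (simp add: mcoeff_reversal algebra_simps)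

lemma reversal_scaleR: "reversal (c *\<^sub>R x) = c *\<^sub>R reversal x"
  by (rule clifford_eqI) (simp add: mcoeff_reversal)

lemma reversal_gen [simp]: "reversal (gen j) = gen j"
  by (rule clifford_eqI) (simp add: mcoeff_reversal gen_def mcoeff_blade)

lemma reversal_sign:
  "finite A \<Longrightarrow> (-1) ^ (card A * (card A - 1) div 2) = msign A A * (-1) ^ card A"
  by (simp add: msign_self mult.assoc)

lemma reversal_mult: "reversal (x * y) = reversal y * reversal x"
proof (rule clifford_eqI)
  fix C
  obtain V where V: "finite V" and
      x: "\<forall>A. mcoeff x A \<noteq> 0 \<longrightarrow> A \<subseteq> V" and y: "\<forall>A. mcoeff y A \<noteq> 0 \<longrightarrow> A \<subseteq> V"
    using exists_frame2 by metis
  have x': "\<forall>A. mcoeff (reversal x) A \<noteq> 0 \<longrightarrow> A \<subseteq> V"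
    and y': "\<forall>A. mcoeff (reversal y) A \<noteq> 0 \<longrightarrow> A \<subseteq> V"
    using x y by (simp_all add: mcoeff_reversal)
  show "mcoeff (reversal (x * y)) C = mcoeff (reversal y * reversal x) C"
    unfolding mcoeff_reversal[of "x * y"] mcoeff_times[OF V x y] mcoeff_times[OF V y' x']
      sum_distrib_left
  proof (subst (2) sum.swap, intro sum.cong refl)
    fix A B assume "A \<in> Pow V" "B \<in> Pow V"
    hence f: "finite A" "finite B" using V finite_subset by auto
    hence fC: "finite (sym_diff A B)" by simp
    have s: "sym_diff B A = sym_diff A B" by blast
    have e: "(-1) ^ (card (sym_diff A B) * (card (sym_diff A B) - 1) div 2) * msign A B
      = msign B A * ((msign A A * (-1) ^ card A) * (msign B B * (-1) ^ card B))"
      unfolding reversal_sign[OF fC] msign_sym_diff_left[OF f] msign_sym_diff_right[OF f]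
        neg_one_power_sym_diff[OF f]
      using msign_sq[of A B] by (simp add: mult_ac)
    show "(-1) ^ (card C * (card C - 1) div 2) *
        (if sym_diff A B = C then msign A B * mcoeff x A * mcoeff y B else 0)
      = (if sym_diff B A = C then msign B A * mcoeff (reversal y) B * mcoeff (reversal x) A else 0)"
    proof (cases "sym_diff A B = C")
      case True
      have "(-1) ^ (card C * (card C - 1) div 2) * (msign A B * mcoeff x A * mcoeff y B)
        = msign B A * mcoeff (reversal y) B * mcoeff (reversal x) A"
        unfolding mcoeff_reversal reversal_sign[OF f(1)] reversal_sign[OF f(2)]
        using e[unfolded True] by (simp add: mult_ac)
      thus ?thesis unfolding s using True by simp
    qed (simp add: s)
  qed
qed

lemma blade_mult:
  assumes "finite A" "finite B"
  shows "blade A * blade B = msign A B *\<^sub>R blade (sym_diff A B)"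
proof (rule clifford_eqI)
  fix C
  have V: "finite (A \<union> B)" "\<forall>C. mcoeff (blade A) C \<noteq> 0 \<longrightarrow> C \<subseteq> A \<union> B"
    "\<forall>C. mcoeff (blade B) C \<noteq> 0 \<longrightarrow> C \<subseteq> A \<union> B"
    using assms by (auto simp: mcoeff_blade)
  have "mcoeff (blade A * blade B) C = (\<Sum>A'\<in>Pow (A \<union> B). \<Sum>B'\<in>Pow (A \<union> B).
      if B' = B then (if A' = A then (if sym_diff A B = C then msign A B else 0) else 0) else 0)"
    unfolding mcoeff_times[OF V]
    by (intro sum.cong refl) (use assms in \<open>simp add: mcoeff_blade\<close>)
  also have "\<dots> = (if sym_diff A B = C then msign A B else 0)"
    using assms by simp
  finally show "mcoeff (blade A * blade B) C = mcoeff (msign A B *\<^sub>R blade (sym_diff A B)) C"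
    using assms by (auto simp: mcoeff_blade)
qed

lemma blade_empty [simp]: "blade {} = 1"
  by (rule clifford_eqI) (simp add: mcoeff_blade mcoeff_one)

lemma gen_sq: "gen j * gen j = -1"
  by (simp add: gen_def blade_mult msign_def)

lemma gen_anticomm: "j \<noteq> k \<Longrightarrow> gen j * gen k = - (gen k * gen j)"
  by (auto simp: gen_def blade_mult msign_def insert_commute Un_commute)

lemma blade_insert:
  assumes "finite A" "\<And>a. a \<in> A \<Longrightarrow> a < j"
  shows "blade (insert j A) = blade A * gen j"
proof -
  have "msign A {j} = 1"
    using assms(2) by (auto simp: msign_def not_le intro!: prod.neutral)
  moreover have "sym_diff A {j} = insert j A" using assms by auto
  ultimately show ?thesis using assms by (simp add: gen_def blade_mult)
qed

lemma inner_eq_scalar_part: "inner x y = scalar_part (x * cconj y)"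
proof -
  obtain V where V: "finite V" and
      x: "\<forall>A. mcoeff x A \<noteq> 0 \<longrightarrow> A \<subseteq> V" and y: "\<forall>A. mcoeff y A \<noteq> 0 \<longrightarrow> A \<subseteq> V"
    using exists_frame2 by metis
  have y': "\<forall>A. mcoeff (cconj y) A \<noteq> 0 \<longrightarrow> A \<subseteq> V"
    using y by (simp add: mcoeff_cconj)
  have "scalar_part (x * cconj y) = (\<Sum>A\<in>Pow V. \<Sum>B\<in>Pow V.
      if B = A then mcoeff x A * mcoeff y A else 0)"
    unfolding scalar_part_def mcoeff_times[OF V x y']
  proof (intro sum.cong refl)
    fix A B assume "A \<in> Pow V" "B \<in> Pow V"
    have "sym_diff A B = {} \<longleftrightarrow> B = A" by blast
    moreover have "msign A A * mcoeff x A * (msign A A * mcoeff y A) = mcoeff x A * mcoeff y A"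
      using msign_sq[of A A] by (simp add: mult_ac)
    ultimately show "(if sym_diff A B = {} then msign A B * mcoeff x A * mcoeff (cconj y) B else 0)
      = (if B = A then mcoeff x A * mcoeff y A else 0)"
      by (auto simp: mcoeff_cconj)
  qed
  thus ?thesis using V by (simp add: inner_frame[OF V x])
qed

lemma cnorm_sq_eq_norm: "cnorm_sq x = (norm x)\<^sup>2"
  by (simp add: cnorm_sq_def power2_norm_eq_inner inner_eq_scalar_part)


section \<open>Paravectors, the Lipschitz group and spinors\<close>

definition Cl :: "nat \<Rightarrow> clifford set" where
  "Cl n = {x. \<forall>A. mcoeff x A \<noteq> 0 \<longrightarrow> A \<subseteq> {1..n}}"

definition paravectors :: "nat \<Rightarrow> clifford set" where
  "paravectors n = span (insert 1 (gen ` {1..n}))"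

definition pv_inner :: "clifford \<Rightarrow> clifford \<Rightarrow> real" where
  "pv_inner V W = scalar_part (V * cconj W)"

inductive_set lipschitz_group :: "nat \<Rightarrow> clifford set" for n where
  one: "1 \<in> lipschitz_group n"
| paravector: "v \<in> paravectors n \<Longrightarrow> v \<noteq> 0 \<Longrightarrow> v \<in> lipschitz_group n"
| mult: "x \<in> lipschitz_group n \<Longrightarrow> y \<in> lipschitz_group n \<Longrightarrow> x * y \<in> lipschitz_group n"
| inverse: "x \<in> lipschitz_group n \<Longrightarrow> y \<in> Cl n \<Longrightarrow> x * y = 1 \<Longrightarrow> y * x = 1 \<Longrightarrow> y \<in> lipschitz_group n"

type_synonym spinor = "clifford \<times> clifford"

definition spinors :: "nat \<Rightarrow> spinor set" where
  "spinors n = {(\<xi>, \<eta>). \<xi> \<in> lipschitz_group n \<union> {0} \<and> \<eta> \<in> lipschitz_group n \<union> {0} \<and>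
     \<not> (\<xi> = 0 \<and> \<eta> = 0) \<and> \<xi> * cconj \<eta> \<in> paravectors n}"

fun spinor_check :: "spinor \<Rightarrow> spinor" where
  "spinor_check (\<xi>, \<eta>) = (grade_inv \<eta>, - grade_inv \<xi>)"

fun spinor_rmult :: "spinor \<Rightarrow> clifford \<Rightarrow> spinor" where
  "spinor_rmult (x, y) a = (x * a, y * a)"

text \<open>The \<open>2 \<times> 2\<close> matrix \<open>\<kappa> v\<^sup>\<dagger>\<close>.\<close>

fun col_dagger :: "spinor \<Rightarrow> spinor \<Rightarrow> clifford ^ 2 ^ 2" where
  "col_dagger (\<xi>, \<eta>) (x, y) =
     vector [vector [\<xi> * cconj x, \<xi> * cconj y], vector [\<eta> * cconj x, \<eta> * cconj y]]"


section \<open>Minkowski space\<close>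

type_synonym minkowski = "real \<times> real \<times> clifford"

definition mink_space :: "nat \<Rightarrow> minkowski set" where
  "mink_space n = {(T, Z, X). X \<in> paravectors n}"

fun mink_form :: "minkowski \<Rightarrow> minkowski \<Rightarrow> real" where
  "mink_form (T, Z, X) (T', Z', X') = T * T' - Z * Z' - pv_inner X X'"

fun mink_matrix :: "minkowski \<Rightarrow> clifford ^ 2 ^ 2" where
  "mink_matrix (T, Z, X) =
     (1 / 2) *\<^sub>R vector [vector [of_real (T + Z), X], vector [cconj X, of_real (T - Z)]]"

definition mink_of_matrix :: "nat \<Rightarrow> clifford ^ 2 ^ 2 \<Rightarrow> minkowski" where
  "mink_of_matrix n = the_inv_into (mink_space n) mink_matrix"

lemma inj_mink_matrix: "inj mink_matrix"
proof (rule injI)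
  fix p q assume eq: "mink_matrix p = mink_matrix q"
  obtain T Z X T' Z' X' where pq: "p = (T, Z, X)" "q = (T', Z', X')"
    by (metis prod_cases3)
  have "mink_matrix p $ i $ j = mink_matrix q $ i $ j" for i j
    by (simp only: eq)
  from this[of 1 1] this[of 1 2] this[of 2 2]
  have "(of_real (T + Z) :: clifford) = of_real (T' + Z')" "X = X'"
       "(of_real (T - Z) :: clifford) = of_real (T' - Z')"
    unfolding pq by simp_all
  hence "T + Z = T' + Z'" "X = X'" "T - Z = T' - Z'"
    by (simp_all only: of_real_eq_iff)
  thus "p = q" unfolding pq by simp
qed

definition light_cone :: "nat \<Rightarrow> minkowski set" where
  "light_cone n = {p \<in> mink_space n. p \<noteq> 0 \<and> mink_form p p = 0 \<and> fst p > 0}"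

definition hyperboloid :: "nat \<Rightarrow> minkowski set" where
  "hyperboloid n = {x \<in> mink_space n. mink_form x x = 1 \<and> fst x > 0}"

definition phi1 :: "nat \<Rightarrow> spinor \<Rightarrow> minkowski" where
  "phi1 n \<kappa> = mink_of_matrix n (col_dagger \<kappa> \<kappa>)"

definition dphi1 :: "nat \<Rightarrow> spinor \<Rightarrow> spinor \<Rightarrow> minkowski" where
  "dphi1 n \<kappa> v = mink_of_matrix n (col_dagger \<kappa> v + col_dagger v \<kappa>)"


section \<open>Flags and oriented lines\<close>

text \<open>
  An orientation of a line \<open>L\<close> is given by its half-line of positive vectors, and one of \<open>F / \<real>p\<close> by
  the preimage in \<open>F\<close> of the positive half-line, an open half-plane.
\<close>

record null_flag =
  flag_line :: "minkowski set"
  flag_plane :: "minkowski set"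
  flag_pos :: "minkowski set"

definition flag :: "minkowski \<Rightarrow> minkowski \<Rightarrow> null_flag" where
  "flag p v = \<lparr>flag_line = span {p}, flag_plane = span {p, v},
     flag_pos = {a *\<^sub>R p + b *\<^sub>R v | a b. b > 0}\<rparr>"

text \<open>
  A multiflag keeps its base point \<open>p\<close>, which is not determined by the flags (only \<open>\<real>p\<close> is, and
  for \<open>n = 0\<close> there are none).
\<close>

type_synonym multiflag = "minkowski \<times> (nat \<Rightarrow> null_flag)"

definition multiflag :: "nat \<Rightarrow> minkowski \<Rightarrow> (nat \<Rightarrow> minkowski) \<Rightarrow> multiflag" where
  "multiflag n p v = (p, \<lambda>j\<in>{1..n}. flag p (v j))"

definition Phi1 :: "nat \<Rightarrow> spinor \<Rightarrow> multiflag" where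
  "Phi1 n \<kappa> =
     multiflag n (phi1 n \<kappa>) (\<lambda>j. dphi1 n \<kappa> (spinor_rmult (spinor_check \<kappa>) (gen j)))"

type_synonym 'a oriented_line = "'a set \<times> 'a set"

definition oriented_line :: "'a::real_vector \<Rightarrow> 'a oriented_line" where
  "oriented_line v = (span {v}, {c *\<^sub>R v | c. c > 0})"

definition map_line :: "('a \<Rightarrow> 'b) \<Rightarrow> 'a oriented_line \<Rightarrow> 'b oriented_line" where
  "map_line f l = (f ` fst l, f ` snd l)"

text \<open>Velocities at \<open>q\<close> of the curves in \<open>S\<close>; used for submanifolds \<open>S\<close> only.\<close>

definition tangent_space :: "'a::real_normed_vector set \<Rightarrow> 'a \<Rightarrow> 'a set" where
  "tangent_space S q = {v. \<exists>\<gamma> :: real \<Rightarrow> 'a.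
     (\<forall>t. \<gamma> t \<in> S) \<and> \<gamma> 0 = q \<and> (\<gamma> has_vector_derivative v) (at 0)}"

definition oriented_line_field ::
    "'a::real_normed_vector set \<Rightarrow> ('a \<Rightarrow> 'a oriented_line) \<Rightarrow> bool" where
  "oriented_line_field S L \<longleftrightarrow>
     (\<forall>q\<in>S. \<exists>v\<in>tangent_space S q. v \<noteq> 0 \<and> L q = oriented_line v)"


section \<open>Decorated horospheres\<close>

definition horosphere :: "nat \<Rightarrow> minkowski \<Rightarrow> minkowski set" where
  "horosphere n p = {x \<in> hyperboloid n. mink_form x p = 1}"

text \<open>A set of points together with the \<open>i\<^sub>j\<close> line fields for \<open>j \<in> {1..n}\<close>.\<close>

type_synonym 'a decorated = "'a set \<times> (nat \<Rightarrow> 'a \<Rightarrow> 'a oriented_line)"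

fun Phi2 :: "nat \<Rightarrow> multiflag \<Rightarrow> minkowski decorated" where
  "Phi2 n (p, F) = (horosphere n p, \<lambda>j\<in>{1..n}. \<lambda>q\<in>horosphere n p.
     (tangent_space (horosphere n p) q \<inter> flag_plane (F j),
      tangent_space (horosphere n p) q \<inter> flag_pos (F j)))"

definition Phi :: "nat \<Rightarrow> spinor \<Rightarrow> minkowski decorated" where
  "Phi n \<kappa> = Phi2 n (Phi1 n \<kappa>)"


section \<open>Upper half-space\<close>

definition uhs :: "nat \<Rightarrow> (real \<times> clifford) set" where
  "uhs n = {(z, x). z > 0 \<and> x \<in> paravectors n}"

text \<open>
  The isometry \<open>\<pi>\<close> of the hyperboloid onto upper half-space. The formula makes sense on the open set
  \<open>T \<noteq> Z\<close> of the ambient vector space, so the differential of \<open>\<pi>\<close> on tangent vectors of the hyperboloid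
  is the restriction of the ambient Frechet derivative.
\<close>

fun uhs_map :: "minkowski \<Rightarrow> real \<times> clifford" where
  "uhs_map (T, Z, X) = (1 / (T - Z), (1 / (T - Z)) *\<^sub>R X)"

definition to_uhs :: "nat \<Rightarrow> minkowski decorated \<Rightarrow> (real \<times> clifford) decorated" where
  "to_uhs n H = (uhs_map ` fst H, \<lambda>j\<in>{1..n}. \<lambda>u\<in>uhs_map ` fst H.
     (let q = the_inv_into (hyperboloid n) uhs_map u
      in map_line (frechet_derivative uhs_map (at q)) (snd H j q)))"

datatype boundary = Finite clifford | Infinity

fun boundary_point :: "minkowski \<Rightarrow> boundary" where
  "boundary_point (T, Z, X) = (if T = Z then Infinity else Finite ((1 / (T - Z)) *\<^sub>R X))"

definition horosphere_centred_at :: "nat \<Rightarrow> (real \<times> clifford) set \<Rightarrow> boundary \<Rightarrow> bool" where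
  "horosphere_centred_at n S b \<longleftrightarrow>
     (\<exists>p\<in>light_cone n. S = uhs_map ` horosphere n p \<and> boundary_point p = b)"

definition horizontal_plane :: "nat \<Rightarrow> real \<Rightarrow> (real \<times> clifford) set" where
  "horizontal_plane n h = {u \<in> uhs n. fst u = h}"

text \<open>
  The Euclidean sphere of diameter \<open>d\<close> tangent to the boundary at \<open>c\<close>, without its point of tangency.
\<close>

definition tangent_sphere :: "nat \<Rightarrow> clifford \<Rightarrow> real \<Rightarrow> (real \<times> clifford) set" where
  "tangent_sphere n c d = {u \<in> uhs n. dist u (d / 2, c) = d / 2}"

definition north_pole :: "(real \<times> clifford) set \<Rightarrow> real \<times> clifford \<Rightarrow> bool" where
  "north_pole S u \<longleftrightarrow> is_arg_max fst (\<lambda>u. u \<in> S) u"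

definition euclidean_diameter :: "(real \<times> clifford) set \<Rightarrow> real \<Rightarrow> bool" where
  "euclidean_diameter S d \<longleftrightarrow> (\<exists>u. north_pole S u \<and> fst u = d)"

definition specified_by ::
    "nat \<Rightarrow> (real \<times> clifford) set \<Rightarrow> (real \<times> clifford \<Rightarrow> (real \<times> clifford) oriented_line)
      \<Rightarrow> clifford \<Rightarrow> bool" where
  "specified_by n S L D \<longleftrightarrow>
     D \<in> paravectors n \<and> D \<noteq> 0 \<and> (\<forall>u\<in>S. L u = oriented_line (0, D))"

definition north_pole_specified_by ::
    "nat \<Rightarrow> (real \<times> clifford) set \<Rightarrow> (real \<times> clifford \<Rightarrow> (real \<times> clifford) oriented_line)
      \<Rightarrow> clifford \<Rightarrow> bool" where
  "north_pole_specified_by n S L D \<longleftrightarrow>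
     D \<in> paravectors n \<and> D \<noteq> 0 \<and> (\<exists>u. north_pole S u \<and> L u = oriented_line (0, D))"

lemma north_pole_tangent_sphere:
  assumes "c \<in> paravectors n" "d > 0"
  shows "north_pole (tangent_sphere n c d) u \<longleftrightarrow> u = (d, c)"
proof -
  have mem: "(d, c) \<in> tangent_sphere n c d"
    using assms by (simp add: tangent_sphere_def uhs_def dist_Pair_Pair dist_real_def)
  have bd: "fst u \<le> d \<and> (fst u = d \<longrightarrow> u = (d, c))" if "u \<in> tangent_sphere n c d" for u
  proof -
    obtain z x where u: "u = (z, x)" by force
    have "dist u (d / 2, c) = d / 2" using that by (simp add: tangent_sphere_def)
    hence "\<bar>z - d / 2\<bar>\<^sup>2 + (dist x c)\<^sup>2 = (d / 2)\<^sup>2"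
      unfolding u dist_Pair_Pair dist_real_def
      by (metis add_nonneg_nonneg real_sqrt_pow2 zero_le_power2)
    hence e: "(z - d / 2)\<^sup>2 + (dist x c)\<^sup>2 = (d / 2)\<^sup>2" by simp
    hence "(z - d / 2)\<^sup>2 \<le> (d / 2)\<^sup>2" by (metis le_add_same_cancel1 zero_le_power2)
    hence "z - d / 2 \<le> d / 2" by (rule power2_le_imp_le) (use assms in simp)
    moreover have "x = c" if "z = d" using e that by simp
    ultimately show ?thesis by (auto simp: u)
  qed
  show ?thesis
    unfolding north_pole_def is_arg_max_linorder using mem bd by (metis antisym fst_conv)
qed


section \<open>Parallel line fields\<close>

text \<open>
  The isometries of hyperbolic space are the (restrictions of) linear maps of Minkowski space that
  preserve the form and the hyperboloid. As usual, a parabolic translation is an isometry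
  conjugate to a translation \<open>(z; x) \<mapsto> (z; x + c)\<close> of upper half-space. Since isometries are linear
  in the hyperboloid model, they coincide with their differentials there.
\<close>

definition mink_isometry :: "nat \<Rightarrow> (minkowski \<Rightarrow> minkowski) \<Rightarrow> bool" where
  "mink_isometry n A \<longleftrightarrow> linear A \<and> A ` mink_space n = mink_space n \<and>
     (\<forall>x\<in>mink_space n. \<forall>y\<in>mink_space n. mink_form (A x) (A y) = mink_form x y) \<and>
     A ` hyperboloid n = hyperboloid n"

definition parabolic_translation :: "nat \<Rightarrow> (minkowski \<Rightarrow> minkowski) \<Rightarrow> bool" where
  "parabolic_translation n A \<longleftrightarrow> mink_isometry n A \<and>
     (\<exists>G B. \<exists>c\<in>paravectors n. mink_isometry n G \<and> mink_isometry n B \<and>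
        (\<forall>q\<in>hyperboloid n. uhs_map (B q) = uhs_map q + (0, c)) \<and>
        (\<forall>x\<in>mink_space n. A (G x) = G (B x)))"

definition parallel_line_field ::
    "nat \<Rightarrow> minkowski set \<Rightarrow> (minkowski \<Rightarrow> minkowski oriented_line) \<Rightarrow> bool" where
  "parallel_line_field n S L \<longleftrightarrow>
     (\<forall>A. parabolic_translation n A \<and> A ` S = S \<longrightarrow> (\<forall>q\<in>S. L (A q) = map_line A (L q)))"

end

(* Put c = \<xi> \<eta>^-1, so that \<xi> = c \<eta>, and k = |\<eta>|^2. Then c is a paravector, and so is Q = \<eta> i_j \<eta>^*, because
   the Lipschitz group acts on paravectors. The i_j flag is spanned by
     p = k (|c|^2 + 1, |c|^2 - 1; 2 c)   and   v = (0, -4 r; 4 r c - 2 (1 + |c|^2) conj Q),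
   where r is the inner product of c and conj Q. At a point q of the horosphere, the combinations of
   p and v orthogonal to q are the multiples of v - (v|q) p, which at the north pole has the direction
   -conj Q = \<eta>' i_j conj \<eta>.
   An isometry A preserving the horosphere fixes p. If A is parabolic, it is conjugate to an explicit
   linear map for which A v - v is a multiple of p, so the line field is invariant. *)

theory Submission
  imports Defs
begin

section \<open>Paravectors and the Lipschitz group\<close>

text \<open>Writing \<open>\<xi> = c * \<eta>\<close> puts the real number
  \<open>\<eta> * cconj \<eta>\<close> or the paravector \<open>Q\<close> inside every matrix entry,
  so the computation stays among paravectors, where \<open>v * cconj w + w * cconj v\<close> is
  real. The obstacle lies in the abstract notions. Tangent spaces are given by curves; explicit
  parabolas in the horosphere supply them, and the same parabolas show that the horosphere
  determines \<open>p\<close>. A parabolic translation is known only up to conjugacy and, through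
  \<open>uhs_map\<close>, only on the hyperboloid; as the hyperboloid spans Minkowski space, its
  conjugate can be computed in the null coordinates T - Z and T + Z. A general isometry fixing
  \<open>p\<close> may rotate the orthogonal complement of \<open>p\<close> modulo \<open>p\<close>;
  a non-trivial translation fixes a single null line, which must be that of \<open>p\<close>, and
  this excludes the rotation.\<close>

lemma gen_in_paravectors: "j \<in> {1..n} \<Longrightarrow> gen j \<in> paravectors n"
  by (simp add: paravectors_def span_base)

lemma zero_in_paravectors [simp]: "0 \<in> paravectors n"
  by (simp add: paravectors_def span_zero)

lemma scaleR_in_paravectors: "v \<in> paravectors n \<Longrightarrow> c *\<^sub>R v \<in> paravectors n"
  by (simp add: paravectors_def span_scale)

lemma add_in_paravectors:
  "v \<in> paravectors n \<Longrightarrow> w \<in> paravectors n \<Longrightarrow> v + w \<in> paravectors n"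
  by (simp add: paravectors_def span_add)

lemma diff_in_paravectors:
  "v \<in> paravectors n \<Longrightarrow> w \<in> paravectors n \<Longrightarrow> v - w \<in> paravectors n"
  by (simp add: paravectors_def span_diff)

lemma paravector_induct [consumes 1, case_names subspace one gen]:
  assumes "v \<in> paravectors n" "subspace {x. P x}" "P 1" "\<And>j. P (gen j)"
  shows "P v"
  using assms(1) unfolding paravectors_def
  by (rule span_induct) (use assms in auto)

section \<open>The three involutions and the inner product\<close>

lemma cconj_add: "cconj (x + y) = cconj x + cconj y"
  by (simp add: cconj_def reversal_add grade_inv_add)

lemma cconj_scaleR: "cconj (a *\<^sub>R x) = a *\<^sub>R cconj x"
  by (simp add: cconj_def reversal_scaleR grade_inv_scaleR)

lemma cconj_zero [simp]: "cconj 0 = 0"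
  using cconj_scaleR[of 0 0] by simp

lemma cconj_minus: "cconj (- x) = - cconj x"
  using cconj_scaleR[of "-1" x] by simp

lemma cconj_diff: "cconj (x - y) = cconj x - cconj y"
  using cconj_add[of x "- y"] by (simp add: cconj_minus)

lemma cconj_one [simp]: "cconj 1 = 1"
  by (simp add: cconj_def)

lemma cconj_mult: "cconj (x * y) = cconj y * cconj x"
  by (simp add: cconj_def grade_inv_mult reversal_mult)

lemma grade_inv_zero [simp]: "grade_inv 0 = 0"
  using grade_inv_scaleR[of 0 0] by simp

lemma reversal_minus: "reversal (- x) = - reversal x"
  using reversal_scaleR[of "-1" x] by simp

lemma reversal_zero [simp]: "reversal 0 = 0"
  using reversal_scaleR[of 0 0] by simp

lemma cconj_gen [simp]: "cconj (gen j) = - gen j"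
  by (simp add: cconj_def reversal_minus)

lemma cconj_cconj [simp]: "cconj (cconj x) = x"
  by (rule clifford_eqI) (simp add: mcoeff_cconj flip: mult.assoc)

lemma grade_inv_grade_inv [simp]: "grade_inv (grade_inv x) = x"
  by (rule clifford_eqI) (simp add: mcoeff_grade_inv flip: mult.assoc)

lemma reversal_reversal [simp]: "reversal (reversal x) = x"
  by (rule clifford_eqI) (simp add: mcoeff_reversal flip: mult.assoc)

lemma grade_inv_reversal: "grade_inv (reversal x) = cconj x"
  unfolding cconj_def
  by (rule clifford_eqI) (simp add: mcoeff_reversal mcoeff_grade_inv)

lemma cconj_grade_inv [simp]: "cconj (grade_inv x) = reversal x"
  by (simp add: cconj_def)

lemma grade_inv_cconj [simp]: "grade_inv (cconj x) = reversal x"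
  by (simp flip: grade_inv_reversal)

lemma reversal_cconj [simp]: "reversal (cconj x) = grade_inv x"
  by (simp add: cconj_def)

lemma cconj_reversal [simp]: "cconj (reversal x) = grade_inv x"
  by (simp add: cconj_def grade_inv_reversal)

text \<open>Conjugation only multiplies the coefficient at \<open>A\<close> by
  \<open>msign A A\<close>, whose square is 1.\<close>

lemma inner_cconj: "inner (cconj x) (cconj y) = inner x y"
proof -
  have nz: "msign A A \<noteq> 0" for A
    by (metis msign_sq mult_zero_left zero_neq_one)
  have m: "msign A A * a * (msign A A * b) = a * b" for A a b
    using msign_sq[of A A] by (simp add: mult_ac)
  show ?thesis
    by (simp add: inner_clifford_def mcoeff_cconj nz m)
qed

lemma norm_cconj [simp]: "norm (cconj x) = norm x"
  by (simp add: norm_eq_sqrt_inner inner_cconj)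

lemma reversal_paravector: "v \<in> paravectors n \<Longrightarrow> reversal v = v"
  by (induction rule: paravector_induct)
     (auto simp: subspace_def reversal_add reversal_scaleR)

lemma grade_inv_paravector: "v \<in> paravectors n \<Longrightarrow> grade_inv v = cconj v"
  by (simp add: reversal_paravector flip: grade_inv_reversal)

lemma cconj_in_paravectors:
  assumes "v \<in> paravectors n"
  shows "cconj v \<in> paravectors n"
  using assms unfolding paravectors_def
proof (rule span_induct)
  show "subspace {x. cconj x \<in> span (insert 1 (gen ` {1..n}))}"
    by (auto simp: subspace_def cconj_add cconj_scaleR span_zero span_add span_scale)
next
  show "cconj x \<in> span (insert 1 (gen ` {1..n}))" if "x \<in> insert 1 (gen ` {1..n})" for x
    using that span_base[OF that] by (auto intro: span_neg simp del: atLeastAtMost_iff)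
qed

section \<open>Clifford relations on paravectors\<close>

lemma gen_nonzero [simp]: "gen j \<noteq> 0"
  using gen_sq[of j] by auto

lemma scalar_part_scaleR_one [simp]: "scalar_part (a *\<^sub>R 1) = a"
  by (simp add: scalar_part_def mcoeff_one)

text \<open>On 1 and the generators the left side is real by the Clifford relations, and bilinearity
  extends this to the span. Taking real parts then identifies the scalar.\<close>

lemma paravector_mult_cconj_add:
  assumes "v \<in> paravectors n" "w \<in> paravectors n"
  shows "v * cconj w + w * cconj v = (2 * inner v w) *\<^sub>R 1"
proof -
  let ?R = "span {1 :: clifford}"
  have g: "gen j * gen k + gen k * gen j \<in> ?R" for j k
  proof (cases "j = k")
    case True
    have "- 1 - 1 \<in> ?R" by (intro span_diff span_neg span_base) simp_all
    thus ?thesis using True by (simp add: gen_sq)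
  next
    case False
    thus ?thesis using gen_anticomm[OF False] by (simp add: span_zero)
  qed
  \<comment> \<open>The expression is symmetric in \<open>v\<close> and \<open>w\<close>, so one
    closure fact serves the inductions on both arguments.\<close>
  have sub: "subspace {v. v * cconj w + w * cconj v \<in> ?R}" for w
  proof -
    have "x * cconj w + w * cconj x + (y * cconj w + w * cconj y) \<in> ?R"
      if "x * cconj w + w * cconj x \<in> ?R" "y * cconj w + w * cconj y \<in> ?R" for x y
      using that by (rule span_add)
    moreover have "a *\<^sub>R (x * cconj w + w * cconj x) \<in> ?R"
      if "x * cconj w + w * cconj x \<in> ?R" for a x
      using that by (rule span_scale)
    ultimately show ?thesis
      by (auto simp: subspace_def cconj_add cconj_scaleR algebra_simps span_zero)
  qed
  have "v * cconj w + w * cconj v \<in> ?R"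
    using assms(1)
  proof (induction rule: paravector_induct)
    case one
    show ?case using assms(2)
    proof (induction rule: paravector_induct)
      case subspace show ?case using sub[of 1] by (simp add: add.commute)
    next
      case one
      have "1 + 1 \<in> ?R" by (intro span_add span_base) simp_all
      thus ?case by simp
    qed (simp add: span_zero)
  next
    case (gen j)
    show ?case using assms(2)
    proof (induction rule: paravector_induct)
      case subspace show ?case using sub[of "gen j"] by (simp add: add.commute)
    next
      case (gen k)
      show ?case using span_neg[OF g[of j k]] by simp
    qed (auto intro: span_zero)
  qed (rule sub)
  then obtain a where a: "v * cconj w + w * cconj v = a *\<^sub>R 1"
    by (auto simp: span_singleton)
  have "scalar_part (v * cconj w + w * cconj v) = 2 * inner v w"
    using inner_eq_scalar_part[of v w] inner_eq_scalar_part[of w v]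
    by (simp add: scalar_part_def inner_commute)
  thus ?thesis using a by simp
qed

lemma paravector_mult_cconj:
  assumes "v \<in> paravectors n"
  shows "v * cconj v = (norm v)\<^sup>2 *\<^sub>R 1"
proof -
  have "2 *\<^sub>R (v * cconj v) = 2 *\<^sub>R ((norm v)\<^sup>2 *\<^sub>R 1)"
    using paravector_mult_cconj_add[OF assms assms]
    by (simp add: power2_norm_eq_inner scaleR_2)
  thus ?thesis by (simp only: scaleR_cancel_left) simp
qed

text \<open>Swap \<open>v * w\<close> by the polarised relation and use that
  \<open>cconj v * v\<close> is real. For \<open>v \<noteq> 0\<close> the result is -|v|^2 times the
  reflection of \<open>cconj w\<close> in the hyperplane orthogonal to \<open>v\<close>.\<close>

lemma paravector_sandwich:
  assumes v: "v \<in> paravectors n" and w: "w \<in> paravectors n"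
  shows "v * w * v = (2 * inner v (cconj w)) *\<^sub>R v - (norm v)\<^sup>2 *\<^sub>R cconj w"
proof -
  have "v * w = (2 * inner v (cconj w)) *\<^sub>R 1 - cconj w * cconj v"
    using paravector_mult_cconj_add[OF v cconj_in_paravectors[OF w]]
    by (simp add: algebra_simps)
  moreover have "cconj v * v = (norm v)\<^sup>2 *\<^sub>R 1"
    using paravector_mult_cconj[OF cconj_in_paravectors[OF v]] by simp
  ultimately show ?thesis
    by (simp add: left_diff_distrib mult.assoc)
qed

text \<open>The induction carries only some non-zero real \<open>r\<close>, because the real factors
  telescope through products and inverses without any multiplicativity of the norm. The real part of
  \<open>x * cconj x\<close> shows \<open>r\<close> to be |x|^2 afterwards.\<close>

lemma lipschitz_group_norm:
  assumes "x \<in> lipschitz_group n"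
  shows "x * cconj x = (norm x)\<^sup>2 *\<^sub>R 1" "cconj x * x = (norm x)\<^sup>2 *\<^sub>R 1" "x \<noteq> 0"
proof -
  have "\<exists>r. r \<noteq> 0 \<and> x * cconj x = r *\<^sub>R 1 \<and> cconj x * x = r *\<^sub>R 1"
    using assms
  proof induction
    case one
    show ?case by (intro exI[of _ 1]) simp
  next
    case (paravector v)
    thus ?case
      using paravector_mult_cconj[of v n] paravector_mult_cconj[OF cconj_in_paravectors, of v n]
      by (intro exI[of _ "(norm v)\<^sup>2"]) simp
  next
    case (mult x y)
    then obtain r s where
      r: "r \<noteq> 0" "x * cconj x = r *\<^sub>R 1" "cconj x * x = r *\<^sub>R 1" and
      s: "s \<noteq> 0" "y * cconj y = s *\<^sub>R 1" "cconj y * y = s *\<^sub>R 1" by blast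
    have "x * y * cconj (x * y) = x * (y * cconj y) * cconj x"
      by (simp add: cconj_mult mult.assoc)
    moreover have "cconj (x * y) * (x * y) = cconj y * (cconj x * x) * y"
      by (simp add: cconj_mult mult.assoc)
    ultimately show ?case using r s by (intro exI[of _ "r * s"]) simp
  next
    case (inverse x y)
    then obtain r where
      r: "r \<noteq> 0" "x * cconj x = r *\<^sub>R 1" "cconj x * x = r *\<^sub>R 1" by blast
    \<comment> \<open>An inverse in the group is a real multiple of the conjugate, so the claim for
      \<open>y\<close> is that for \<open>x\<close> with the factors exchanged.\<close>
    have "cconj x = y * x * cconj x" using inverse by simp
    also have "\<dots> = r *\<^sub>R y" using r by (simp add: mult.assoc)
    finally have y: "y = (1 / r) *\<^sub>R cconj x" using r by simp
    show ?case using r by (intro exI[of _ "1 / r"]) (simp add: y cconj_scaleR)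
  qed
  then obtain r where r: "r \<noteq> 0" "x * cconj x = r *\<^sub>R 1" "cconj x * x = r *\<^sub>R 1" by blast
  have "(norm x)\<^sup>2 = r"
    using r by (simp flip: cnorm_sq_eq_norm add: cnorm_sq_def)
  thus "x * cconj x = (norm x)\<^sup>2 *\<^sub>R 1" "cconj x * x = (norm x)\<^sup>2 *\<^sub>R 1" "x \<noteq> 0"
    using r by auto
qed

text \<open>The induction needs both sandwiches: an inverse is a multiple of \<open>cconj x\<close>,
  so up to \<open>grade_inv\<close> and conjugation of \<open>v\<close> the sandwich by the inverse
  is the opposite sandwich by \<open>x\<close>.\<close>

lemma lipschitz_group_sandwich:
  assumes "x \<in> lipschitz_group n" "v \<in> paravectors n"
  shows "x * v * reversal x \<in> paravectors n"
proof -
  have "\<forall>v\<in>paravectors n. x * v * reversal x \<in> paravectors n \<and> reversal x * v * x \<in> paravectors n"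
    using assms(1)
  proof induction
    case (paravector w)
    thus ?case
      by (auto simp: reversal_paravector paravector_sandwich
          intro!: diff_in_paravectors scaleR_in_paravectors cconj_in_paravectors)
  next
    case (mult x y)
    have a: "x * y * v * reversal (x * y) = x * (y * v * reversal y) * reversal x"
      and b: "reversal (x * y) * v * (x * y) = reversal y * (reversal x * v * x) * y" for v
      by (simp_all add: reversal_mult mult.assoc)
    show ?case using mult.IH unfolding a b by blast
  next
    case (inverse x y)
    have "cconj x = y * x * cconj x" using inverse by simp
    also have "\<dots> = (norm x)\<^sup>2 *\<^sub>R y"
      using lipschitz_group_norm[OF inverse.hyps(1)] by (simp add: mult.assoc)
    finally have y: "y = (1 / (norm x)\<^sup>2) *\<^sub>R cconj x"
      using lipschitz_group_norm(3)[OF inverse.hyps(1)] by simp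
    show ?case
    proof (intro ballI conjI)
      fix v assume v: "v \<in> paravectors n"
      let ?r = "1 / (norm x)\<^sup>2 * (1 / (norm x)\<^sup>2)"
      have v': "cconj v \<in> paravectors n" using v by (rule cconj_in_paravectors)
      have "y * v * reversal y = ?r *\<^sub>R grade_inv (reversal x * cconj v * x)"
        using v v' by (simp add: y reversal_scaleR grade_inv_mult grade_inv_reversal
            grade_inv_paravector reversal_paravector)
      moreover have "grade_inv (reversal x * cconj v * x) \<in> paravectors n"
        using inverse.IH v' by (metis grade_inv_paravector cconj_in_paravectors)
      ultimately show "y * v * reversal y \<in> paravectors n"
        by (metis scaleR_in_paravectors)
      have "reversal y * v * y = ?r *\<^sub>R grade_inv (x * cconj v * reversal x)"
        using v v' by (simp add: y reversal_scaleR grade_inv_mult grade_inv_reversal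
            grade_inv_paravector reversal_paravector)
      moreover have "grade_inv (x * cconj v * reversal x) \<in> paravectors n"
        using inverse.IH v' by (metis grade_inv_paravector cconj_in_paravectors)
      ultimately show "reversal y * v * y \<in> paravectors n"
        by (metis scaleR_in_paravectors)
    qed
  qed simp
  thus ?thesis using assms(2) by blast
qed

text \<open>Multiplying by \<open>cconj x\<close> on the left and by \<open>grade_inv x\<close> on
  the right recovers |x|^4 \<open>v\<close>.\<close>

lemma lipschitz_group_sandwich_nonzero:
  assumes "x \<in> lipschitz_group n" "v \<noteq> 0"
  shows "x * v * reversal x \<noteq> 0"
proof
  assume z: "x * v * reversal x = 0"
  have "reversal x * grade_inv x = grade_inv (cconj x * x)"
    by (simp add: grade_inv_mult)
  also have "\<dots> = (norm x)\<^sup>2 *\<^sub>R 1"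
    using lipschitz_group_norm[OF assms(1)] by (simp add: grade_inv_scaleR)
  finally have r: "reversal x * grade_inv x = (norm x)\<^sup>2 *\<^sub>R 1" .
  have "cconj x * (x * v * reversal x) * grade_inv x = (cconj x * x) * v * (reversal x * grade_inv x)"
    by (simp add: mult.assoc)
  thus False
    using assms z r lipschitz_group_norm[OF assms(1)] by simp
qed

lemma cinv_lipschitz_group:
  assumes "x \<in> lipschitz_group n"
  shows "cinv x = (1 / (norm x)\<^sup>2) *\<^sub>R cconj x"
  unfolding cinv_def
proof (rule the_equality)
  show inv: "x * ((1 / (norm x)\<^sup>2) *\<^sub>R cconj x) = 1 \<and> ((1 / (norm x)\<^sup>2) *\<^sub>R cconj x) * x = 1"
    using lipschitz_group_norm[OF assms] by simp
  fix y assume "x * y = 1 \<and> y * x = 1"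
  thus "y = (1 / (norm x)\<^sup>2) *\<^sub>R cconj x"
    using inv by (metis mult.assoc mult_1_left mult_1_right)
qed

section \<open>Minkowski space and horospheres\<close>

text \<open>Treating (Z, X) as one vector of a product inner product space gives bilinearity and
  Cauchy-Schwarz at once.\<close>

lemma mink_form_eq: "mink_form p q = fst p * fst q - inner (snd p) (snd q)"
  by (cases p; cases q) (simp add: pv_inner_def inner_prod_def flip: inner_eq_scalar_part)

lemma mink_form_sym: "mink_form p q = mink_form q p"
  by (simp add: mink_form_eq inner_commute mult.commute)

lemma mink_form_linear:
  "mink_form (p + q) r = mink_form p r + mink_form q r"
  "mink_form (p - q) r = mink_form p r - mink_form q r"
  "mink_form (a *\<^sub>R p) r = a * mink_form p r"
  "mink_form r (p + q) = mink_form r p + mink_form r q"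
  "mink_form r (p - q) = mink_form r p - mink_form r q"
  "mink_form r (a *\<^sub>R p) = a * mink_form r p"
  by (simp_all add: mink_form_eq algebra_simps inner_add_left inner_add_right
      inner_diff_left inner_diff_right)

lemma subspace_mink_space: "subspace (mink_space n)"
  by (auto simp: subspace_def mink_space_def zero_prod_def
      intro: add_in_paravectors scaleR_in_paravectors)

lemmas mink_space_closed =
  subspace_add[OF subspace_mink_space] subspace_diff[OF subspace_mink_space]
  subspace_mul[OF subspace_mink_space]

lemma mink_form_nondegenerate:
  assumes "x \<in> mink_space n" "\<And>y. y \<in> mink_space n \<Longrightarrow> mink_form x y = 0"
  shows "x = 0"
proof -
  obtain T Z X where x: "x = (T, Z, X)" by (cases x)
  \<comment> \<open>Pairing with this vector yields the Euclidean square norm of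
    \<open>x\<close>.\<close>
  have "(T, - Z, - X) \<in> mink_space n"
    using assms(1) scaleR_in_paravectors[of X n "-1"] by (simp add: mink_space_def x)
  hence "T * T + Z * Z + inner X X = 0"
    using assms(2) by (force simp: mink_form_eq x)
  hence "inner (T, Z, X) (T, Z, X) = 0" by (simp add: inner_prod_def)
  thus ?thesis by (simp add: x del: inner_Pair)
qed

text \<open>By Cauchy-Schwarz, a timelike vector with T \<le> 0 pairs non-positively with a future
  null vector. Membership in a horosphere thereby reduces to polynomial equations on Minkowski
  space.\<close>

lemma timelike_positive:
  assumes p: "p \<in> light_cone n" and x: "mink_form x x = 1" "mink_form x p = 1"
  shows "fst x > 0"
proof (rule ccontr)
  assume neg: "\<not> fst x > 0"
  have "(norm (snd p))\<^sup>2 = (fst p)\<^sup>2"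
    using p by (simp add: light_cone_def mink_form_eq power2_norm_eq_inner power2_eq_square[of "fst p"])
  hence np: "norm (snd p) = fst p"
    using p by (simp add: light_cone_def power2_eq_iff_nonneg)
  have "(norm (snd x))\<^sup>2 \<le> (- fst x)\<^sup>2"
    using x by (simp add: mink_form_eq power2_norm_eq_inner power2_eq_square[of "fst x"])
  hence nx: "norm (snd x) \<le> - fst x"
    by (rule power2_le_imp_le) (use neg in simp)
  have "- inner (snd x) (snd p) \<le> norm (snd x) * norm (snd p)"
    using norm_cauchy_schwarz[of "- snd x" "snd p"] by simp
  also have "\<dots> \<le> - fst x * fst p"
    using nx p unfolding np by (intro mult_right_mono) (auto simp: light_cone_def)
  finally show False using x by (simp add: mink_form_eq)
qed

lemma in_horosphere_iff:
  assumes "p \<in> light_cone n"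
  shows "x \<in> horosphere n p \<longleftrightarrow> x \<in> mink_space n \<and> mink_form x x = 1 \<and> mink_form x p = 1"
  unfolding horosphere_def hyperboloid_def using timelike_positive[OF assms, of x] by blast

text \<open>
  The parabola below is the orbit of \<open>q\<close> under a one-parameter group of parabolic translations.
\<close>

lemma horosphere_curve:
  assumes p: "p \<in> light_cone n" and q: "q \<in> horosphere n p" and t: "t \<in> mink_space n"
    and tp: "mink_form t p = 0" and tq: "mink_form t q = 0"
  shows "q + s *\<^sub>R t - (s\<^sup>2 * mink_form t t / 2) *\<^sub>R p \<in> horosphere n p"
proof -
  have pp: "mink_form p p = 0" "p \<in> mink_space n" using p by (auto simp: light_cone_def)
  have qq: "mink_form q q = 1" "mink_form q p = 1" "q \<in> mink_space n"
    using q in_horosphere_iff[OF p] by auto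
  show ?thesis
    unfolding in_horosphere_iff[OF p]
    using pp qq t tp tq mink_form_sym[of p q] mink_form_sym[of p t] mink_form_sym[of q t]
    by (auto simp: mink_form_linear algebra_simps power2_eq_square intro!: mink_space_closed)
qed

text \<open>The parabola is a curve in the horosphere, and its quadratic correction does not affect
  the velocity at 0.\<close>

lemma tangent_space_horosphereI:
  assumes "p \<in> light_cone n" "q \<in> horosphere n p" "t \<in> mink_space n"
    "mink_form t p = 0" "mink_form t q = 0"
  shows "t \<in> tangent_space (horosphere n p) q"
  unfolding tangent_space_def
proof (intro CollectI exI conjI allI)
  let ?\<gamma> = "\<lambda>s. q + s *\<^sub>R t - (s\<^sup>2 * mink_form t t / 2) *\<^sub>R p"
  show "?\<gamma> s \<in> horosphere n p" for s using horosphere_curve[OF assms] .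
  show "?\<gamma> 0 = q" by simp
  show "(?\<gamma> has_vector_derivative t) (at 0)"
    by (auto intro!: derivative_eq_intros simp: has_vector_derivative_def)
qed

text \<open>Along a curve in the horosphere both defining equations are constant; differentiate them
  at 0.\<close>

lemma tangent_space_horosphereD:
  assumes "t \<in> tangent_space (horosphere n p) q"
  shows "mink_form t p = 0" "mink_form t q = 0"
proof -
  obtain \<gamma> :: "real \<Rightarrow> minkowski" where \<gamma>: "\<And>s. \<gamma> s \<in> horosphere n p" "\<gamma> 0 = q"
    and d: "(\<gamma> has_derivative (\<lambda>h. h *\<^sub>R t)) (at 0)"
    using assms unfolding tangent_space_def has_vector_derivative_def by auto
  have c: "mink_form (\<gamma> s) p = 1" "mink_form (\<gamma> s) (\<gamma> s) = 1" for s
    using \<gamma>(1)[of s] by (auto simp: horosphere_def hyperboloid_def)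
  have "((\<lambda>s. mink_form (\<gamma> s) p) has_derivative (\<lambda>h. mink_form (h *\<^sub>R t) p)) (at 0)"
    unfolding mink_form_eq by (auto intro!: derivative_eq_intros d)
  moreover have "((\<lambda>s. mink_form (\<gamma> s) p) has_derivative (\<lambda>h. 0)) (at 0)"
    unfolding c by simp
  ultimately have "(\<lambda>h. mink_form (h *\<^sub>R t) p) = (\<lambda>h. 0)" by (rule has_derivative_unique)
  from fun_cong[OF this, of 1] show "mink_form t p = 0" by simp
  have "((\<lambda>s. mink_form (\<gamma> s) (\<gamma> s)) has_derivative (\<lambda>h. 2 * mink_form (h *\<^sub>R t) q)) (at 0)"
    unfolding mink_form_eq
    by (auto intro!: derivative_eq_intros d simp: \<gamma>(2) fun_eq_iff inner_commute algebra_simps)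
  moreover have "((\<lambda>s. mink_form (\<gamma> s) (\<gamma> s)) has_derivative (\<lambda>h. 0)) (at 0)"
    unfolding c by simp
  ultimately have "(\<lambda>h. 2 * mink_form (h *\<^sub>R t) q) = (\<lambda>h. 0)" by (rule has_derivative_unique)
  from fun_cong[OF this, of 1] show "mink_form t q = 0" by simp
qed

section \<open>The line field of a flag\<close>

definition flag_tangent :: "minkowski \<Rightarrow> minkowski \<Rightarrow> minkowski \<Rightarrow> minkowski" where
  "flag_tangent p v q = v - mink_form v q *\<^sub>R p"

text \<open>For \<open>v\<close> orthogonal to \<open>p\<close>, negativity of
  \<open>mink_form v v\<close> expresses independence of \<open>p\<close> in a form unaffected by
  adding multiples of \<open>p\<close>, so it passes to \<open>flag_tangent p v q\<close>.\<close>

locale flagged_horosphere =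
  fixes n :: nat and p v :: minkowski
  assumes p: "p \<in> light_cone n" and v: "v \<in> mink_space n"
    and pv: "mink_form p v = 0" and spacelike: "mink_form v v < 0"
begin

lemma p_props: "mink_form p p = 0" "p \<in> mink_space n" "mink_form v p = 0"
  using p pv mink_form_sym by (auto simp: light_cone_def)

lemma horosphere_props:
  assumes "q \<in> horosphere n p"
  shows "q \<in> mink_space n" "mink_form q q = 1" "mink_form q p = 1" "mink_form p q = 1"
  using assms mink_form_sym[of p q] by (auto simp: horosphere_def hyperboloid_def)

lemma flag_tangent_props:
  assumes "q \<in> horosphere n p"
  shows "flag_tangent p v q \<in> mink_space n" "mink_form (flag_tangent p v q) p = 0"
    "mink_form (flag_tangent p v q) q = 0" "mink_form (flag_tangent p v q) (flag_tangent p v q) < 0"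
    "flag_tangent p v q \<in> tangent_space (horosphere n p) q" "flag_tangent p v q \<noteq> 0"
proof -
  show 1: "flag_tangent p v q \<in> mink_space n"
    unfolding flag_tangent_def using v p_props by (intro mink_space_closed)
  show 2: "mink_form (flag_tangent p v q) p = 0" "mink_form (flag_tangent p v q) q = 0"
    using p_props horosphere_props[OF assms] by (simp_all add: flag_tangent_def mink_form_linear)
  show 3: "mink_form (flag_tangent p v q) (flag_tangent p v q) < 0"
    using p_props horosphere_props[OF assms] pv spacelike
    by (simp add: flag_tangent_def mink_form_linear)
  show "flag_tangent p v q \<in> tangent_space (horosphere n p) q"
    using p assms 1 2 by (rule tangent_space_horosphereI)
  show "flag_tangent p v q \<noteq> 0" using 3 by (auto simp: mink_form_eq)
qed

text \<open>For \<open>a p + b v\<close> orthogonality to \<open>p\<close> is automatic, and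
  orthogonality to \<open>q\<close> forces \<open>a = - b (v|q)\<close>. The coefficient
  \<open>b\<close> is kept, so the positive half-plane of the flag meets the line in its positive
  half.\<close>

lemma flag_line_eq:
  assumes q: "q \<in> horosphere n p"
  shows "(tangent_space (horosphere n p) q \<inter> flag_plane (flag p v),
      tangent_space (horosphere n p) q \<inter> flag_pos (flag p v)) = oriented_line (flag_tangent p v q)"
proof -
  have tan: "a *\<^sub>R p + b *\<^sub>R v = b *\<^sub>R flag_tangent p v q"
    if "a *\<^sub>R p + b *\<^sub>R v \<in> tangent_space (horosphere n p) q" for a b
  proof -
    have "a + b * mink_form v q = 0"
      using tangent_space_horosphereD(2)[OF that] horosphere_props[OF q]
      by (simp add: mink_form_linear)
    hence "a = - (b * mink_form v q)" by simp
    thus ?thesis by (simp add: flag_tangent_def algebra_simps)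
  qed
  have in_tan: "b *\<^sub>R flag_tangent p v q \<in> tangent_space (horosphere n p) q" for b
    using flag_tangent_props[OF q] p q
    by (intro tangent_space_horosphereI) (simp_all add: mink_form_linear mink_space_closed)
  have form: "b *\<^sub>R flag_tangent p v q = (- b * mink_form v q) *\<^sub>R p + b *\<^sub>R v" for b
    by (simp add: flag_tangent_def algebra_simps)
  have plane: "x \<in> flag_plane (flag p v) \<longleftrightarrow> (\<exists>a b. x = a *\<^sub>R p + b *\<^sub>R v)" for x
    by (simp add: flag_def span_breakdown_eq span_singleton image_iff diff_eq_eq add.commute)
  have pos: "x \<in> flag_pos (flag p v) \<longleftrightarrow> (\<exists>a b. x = a *\<^sub>R p + b *\<^sub>R v \<and> b > 0)" for x
    by (simp add: flag_def)
  have "tangent_space (horosphere n p) q \<inter> flag_plane (flag p v) = span {flag_tangent p v q}"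
  proof (intro equalityI subsetI)
    fix x assume "x \<in> tangent_space (horosphere n p) q \<inter> flag_plane (flag p v)"
    then obtain b where "x = b *\<^sub>R flag_tangent p v q" using tan plane by (metis IntD1 IntD2)
    thus "x \<in> span {flag_tangent p v q}" by (simp add: span_base span_scale)
  next
    fix x assume "x \<in> span {flag_tangent p v q}"
    then obtain b where "x = b *\<^sub>R flag_tangent p v q" by (auto simp: span_singleton)
    thus "x \<in> tangent_space (horosphere n p) q \<inter> flag_plane (flag p v)"
      using in_tan[of b] plane form[of b] by blast
  qed
  moreover have "tangent_space (horosphere n p) q \<inter> flag_pos (flag p v)
      = {b *\<^sub>R flag_tangent p v q | b. b > 0}"
  proof (intro equalityI subsetI)
    fix x assume "x \<in> tangent_space (horosphere n p) q \<inter> flag_pos (flag p v)"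
    then obtain b where "x = b *\<^sub>R flag_tangent p v q" "b > 0" using tan pos by (metis IntD1 IntD2)
    thus "x \<in> {b *\<^sub>R flag_tangent p v q | b. b > 0}" by blast
  next
    fix x assume "x \<in> {b *\<^sub>R flag_tangent p v q | b. b > 0}"
    then obtain b where "x = b *\<^sub>R flag_tangent p v q" "b > 0" by blast
    thus "x \<in> tangent_space (horosphere n p) q \<inter> flag_pos (flag p v)"
      using in_tan[of b] pos form[of b] by blast
  qed
  ultimately show ?thesis by (simp add: oriented_line_def)
qed

end

declare mink_form.simps [simp del]

section \<open>Invariance under parabolic translations\<close>

text \<open>The hyperboloid spans: changing only T moves \<open>x\<close> onto it, at the cost of a
  multiple of the hyperboloid point (1, 0, 0).\<close>

lemma linear_eq_mink_spaceI:
  assumes f: "linear f" and g: "linear g" and eq: "\<And>q. q \<in> hyperboloid n \<Longrightarrow> f q = g q"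
    and x: "x \<in> mink_space n"
  shows "f x = g x"
proof -
  obtain T Z X where x': "x = (T, Z, X)" by (cases x)
  have X: "X \<in> paravectors n" using x by (simp add: x' mink_space_def)
  define h where "h = (sqrt (1 + Z\<^sup>2 + (norm X)\<^sup>2), Z, X)"
  define e :: minkowski where "e = (1, 0, 0)"
  have pos: "1 + Z\<^sup>2 + (norm X)\<^sup>2 > 0"
    by (simp add: add_pos_nonneg)
  have "sqrt (1 + Z\<^sup>2 + (norm X)\<^sup>2) * sqrt (1 + Z\<^sup>2 + (norm X)\<^sup>2) = 1 + Z * Z + inner X X"
    using pos by (simp add: power2_norm_eq_inner power2_eq_square[of Z])
  hence "h \<in> hyperboloid n"
    using X pos by (simp add: h_def hyperboloid_def mink_space_def mink_form_eq
        del: real_sqrt_mult_self)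
  moreover have "e \<in> hyperboloid n"
    by (simp add: e_def hyperboloid_def mink_space_def mink_form_eq)
  moreover have "x = h + (T - fst h) *\<^sub>R e" by (simp add: h_def e_def x')
  ultimately show ?thesis
    using eq f g by (simp add: linear_add linear_scale)
qed

text \<open>The hyperboloid equation reads (T - Z)(T + Z) = 1 + |X|^2, and the factors have positive
  sum 2T.\<close>

lemma hyperboloid_height_pos:
  assumes "(T, Z, X) \<in> hyperboloid n"
  shows "T - Z > 0"
proof (rule ccontr)
  assume "\<not> T - Z > 0"
  hence "T - Z \<le> 0" "T + Z \<ge> 0" using assms by (auto simp: hyperboloid_def)
  hence "(T - Z) * (T + Z) \<le> 0" by (rule mult_nonpos_nonneg)
  moreover have "(T - Z) * (T + Z) = 1 + (norm X)\<^sup>2"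
    using assms
    by (simp add: hyperboloid_def mink_form_eq power2_norm_eq_inner algebra_simps)
  moreover have "(norm X)\<^sup>2 \<ge> 0" by simp
  ultimately show False by linarith
qed

text \<open>The null rotation about the line of (1, 1, 0), the null direction over
  \<open>Infinity\<close>.\<close>

definition null_translation :: "clifford \<Rightarrow> minkowski \<Rightarrow> minkowski" where
  "null_translation c x = x
     + (inner (snd (snd x)) c + (fst x - fst (snd x)) * (norm c)\<^sup>2 / 2) *\<^sub>R (1, 1, 0)
     + (0, 0, (fst x - fst (snd x)) *\<^sub>R c)"

lemma linear_null_translation: "linear (null_translation c)"
  by (rule linearI)
     (auto simp: null_translation_def inner_add_left algebra_simps add_divide_distrib diff_divide_distrib)

text \<open>On the hyperboloid, the action on upper half-space keeps T - Z = 1/z and replaces X by X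
  + (T - Z) c. The hyperboloid equation then gives T + Z, and linearity extends the formula to all
  of Minkowski space.\<close>

lemma uhs_translation_eq_null_translation:
  assumes B: "mink_isometry n B" "\<And>q. q \<in> hyperboloid n \<Longrightarrow> uhs_map (B q) = uhs_map q + (0, c)"
    and x: "x \<in> mink_space n"
  shows "B x = null_translation c x"
proof (rule linear_eq_mink_spaceI[OF _ linear_null_translation _ x])
  show "linear B" using B by (simp add: mink_isometry_def)
  fix q assume q: "q \<in> hyperboloid n"
  obtain T Z X where q': "q = (T, Z, X)" by (cases q)
  obtain T' Z' X' where Bq: "B q = (T', Z', X')" by (cases "B q")
  have "B q \<in> hyperboloid n" using B(1) q by (auto simp: mink_isometry_def)
  hence h: "(T', Z', X') \<in> hyperboloid n" "(T, Z, X) \<in> hyperboloid n" using q q' Bq by simp_all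
  note pos = this[THEN hyperboloid_height_pos]
  have "uhs_map (T', Z', X') = uhs_map (T, Z, X) + (0, c)"
    using B(2)[OF q] unfolding Bq unfolding q' .
  hence u: "1 / (T' - Z') = 1 / (T - Z)" "(1 / (T - Z)) *\<^sub>R X' = (1 / (T - Z)) *\<^sub>R X + c"
    by auto
  define s where "s = T - Z"
  have s: "T' - Z' = s" "T - Z = s" "s > 0" using u pos by (auto simp: s_def field_simps)
  have "s *\<^sub>R ((1 / s) *\<^sub>R X') = s *\<^sub>R ((1 / s) *\<^sub>R X + c)" using u s by simp
  hence X': "X' = X + s *\<^sub>R c" using s by (simp add: scaleR_add_right)
  have "(T' - Z') * (T' + Z') = 1 + inner X' X'" "(T - Z) * (T + Z) = 1 + inner X X"
    using h by (simp_all add: hyperboloid_def mink_form_eq algebra_simps)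
  hence "s * (T' + Z') = s * (T + Z + 2 * inner X c + s * inner c c)"
    unfolding s X' by (simp add: inner_add_left inner_add_right inner_commute algebra_simps)
  hence "T' + Z' = T + Z + 2 * inner X c + s * inner c c" using s by simp
  hence "T' = T + inner X c + s * inner c c / 2" "Z' = Z + inner X c + s * inner c c / 2"
    using s by (simp_all add: field_simps)
  thus "B q = null_translation c q"
    unfolding Bq unfolding q' using s by (simp add: X' null_translation_def power2_norm_eq_inner algebra_simps)
qed

lemma mink_isometry_inj:
  assumes G: "mink_isometry n G" and x: "x \<in> mink_space n" "y \<in> mink_space n" "G x = G y"
  shows "x = y"
proof -
  have "x - y = 0"
  proof (rule mink_form_nondegenerate)
    show "x - y \<in> mink_space n" using x by (intro mink_space_closed)
    fix z assume z: "z \<in> mink_space n"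
    have "mink_form x z = mink_form (G x) (G z)" "mink_form y z = mink_form (G y) (G z)"
      using G x(1,2) z by (auto simp: mink_isometry_def)
    thus "mink_form (x - y) z = 0" using x by (simp add: mink_form_linear)
  qed
  thus ?thesis by simp
qed

text \<open>
  A non-trivial translation in the normal form above fixes no null vector outside \<open>\<real>(1, 1; 0)\<close>,
  and it acts trivially on \<open>(1, 1; 0)\<^sup>\<bottom> / \<real>(1, 1; 0)\<close>.
\<close>

lemma parabolic_translation_flag:
  assumes A: "parabolic_translation n A" and p: "p \<in> mink_space n" "p \<noteq> 0" "mink_form p p = 0"
    and v: "v \<in> mink_space n" "mink_form p v = 0" and fix_p: "A p = p"
  shows "\<exists>\<mu>. A v = v + \<mu> *\<^sub>R p"
proof -
  obtain G B c where G: "mink_isometry n G" and B: "mink_isometry n B"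
    and Bu: "\<forall>q\<in>hyperboloid n. uhs_map (B q) = uhs_map q + (0, c)"
    and AG: "\<forall>x\<in>mink_space n. A (G x) = G (B x)"
    using A by (auto simp: parabolic_translation_def)
  have Bx: "B x = null_translation c x" if "x \<in> mink_space n" for x
    using B Bu that by (intro uhs_translation_eq_null_translation) auto
  have lin: "linear G" and Gim: "G ` mink_space n = mink_space n"
    and Gform: "\<And>x y. x \<in> mink_space n \<Longrightarrow> y \<in> mink_space n \<Longrightarrow> mink_form (G x) (G y) = mink_form x y"
    using G by (auto simp: mink_isometry_def)
  \<comment> \<open>Pulling \<open>p\<close> and \<open>v\<close> back along \<open>G\<close> turns
    \<open>A\<close> into \<open>null_translation c\<close>.\<close>
  obtain P V where P: "P \<in> mink_space n" "p = G P" and V: "V \<in> mink_space n" "v = G V"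
    using p v Gim by (metis imageE)
  have Bim: "B P \<in> mink_space n" using B P by (auto simp: mink_isometry_def)
  have "G (B P) = G P" using AG P fix_p by simp
  hence BP: "null_translation c P = P"
    using mink_isometry_inj[OF G Bim P(1)] Bx P by simp
  obtain T Z X where P': "P = (T, Z, X)" by (cases P)
  show ?thesis
  proof (cases "c = 0")
    case True
    hence "null_translation c V = V" by (simp add: null_translation_def flip: zero_prod_def)
    hence "A v = v" using AG V Bx by simp
    thus ?thesis by (intro exI[of _ 0]) simp
  next
    case False
    \<comment> \<open>The X component of \<open>BP\<close> says that (T - Z) c = 0.\<close>
    hence TZ: "T = Z" using BP by (auto simp: P' null_translation_def prod_eq_iff)
    have "mink_form P P = 0" "P \<noteq> 0" using p P Gform lin by (auto simp: linear_0)
    hence X: "X = 0" and T: "T \<noteq> 0"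
      using TZ by (auto simp: P' mink_form_eq zero_prod_def)
    obtain T' Z' X' where V': "V = (T', Z', X')" by (cases V)
    have "mink_form P V = 0" using v P V Gform by simp
    hence "T' = Z'" using T by (simp add: P' V' X TZ[symmetric] mink_form_eq)
    \<comment> \<open>With T' = Z', only \<open>inner X' c\<close> times (1, 1, 0) is added, and (1,
      1, 0) is \<open>P\<close> divided by T.\<close>
    hence "B V = V + (inner X' c / T) *\<^sub>R P"
      using T Bx[OF V(1)] by (simp add: V' P' null_translation_def X TZ[symmetric])
    hence "A v = v + (inner X' c / T) *\<^sub>R p"
      using AG V P lin by (simp add: linear_add linear_scale)
    thus ?thesis by blast
  qed
qed

lemma map_line_oriented_line:
  assumes "linear f"
  shows "map_line f (oriented_line t) = oriented_line (f t)"
  using linear_span_image[OF assms, of "{t}"]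
  by (simp add: map_line_def oriented_line_def setcompr_eq_image image_image linear_scale[OF assms])

context flagged_horosphere
begin

text \<open>The horosphere determines its base point \<open>p\<close>, which is therefore fixed.\<close>

lemma isometry_fixes_base:
  assumes A: "mink_isometry n A" and S: "A ` horosphere n p = horosphere n p"
    and q: "q \<in> horosphere n p"
  shows "A p = p"
proof -
  define d where "d = A p - p"
  have Ap: "A p \<in> mink_space n" using A p_props by (auto simp: mink_isometry_def)
  have d0: "mink_form x d = 0" if x: "x \<in> horosphere n p" for x
  proof -
    obtain y where y: "y \<in> horosphere n p" "x = A y" using S x by (metis imageE)
    have "mink_form (A y) (A p) = mink_form y p"
      using A p_props horosphere_props[OF y(1)] by (auto simp: mink_isometry_def)
    thus ?thesis
      using horosphere_props[OF x] horosphere_props[OF y(1)] by (simp add: d_def mink_form_linear y)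
  qed
  \<comment> \<open>Since (q|d) = 0, the parabola at \<open>s\<close> gives s (t|d) = s^2 (t|t)
    (p|d) / 2. The values 1 and -1 separate the odd and even parts.\<close>
  have t0: "mink_form t d = 0 \<and> mink_form t t * mink_form p d = 0"
    if "t \<in> mink_space n" "mink_form t p = 0" "mink_form t q = 0" for t
  proof -
    note c = d0[OF horosphere_curve[OF p q that]]
    have "mink_form t d = mink_form t t * mink_form p d / 2"
      "- mink_form t d = mink_form t t * mink_form p d / 2"
      using c[of 1] c[of "-1"] d0[OF q] by (simp_all add: mink_form_linear)
    thus ?thesis by linarith
  qed
  \<comment> \<open>The flag supplies a tangent vector that is not null.\<close>
  have pd: "mink_form p d = 0"
    using t0[of "flag_tangent p v q"] flag_tangent_props[OF q] by simp
  have "d = 0"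
  proof (rule mink_form_nondegenerate)
    show "d \<in> mink_space n" unfolding d_def using Ap p_props by (intro mink_space_closed)
    fix y assume y: "y \<in> mink_space n"
    \<comment> \<open>The component of \<open>y\<close> orthogonal to the plane of \<open>p\<close>
      and \<open>q\<close>; \<open>d\<close> is orthogonal to it and to both \<open>p\<close> and
      \<open>q\<close>.\<close>
    let ?t = "y - mink_form y p *\<^sub>R q - (mink_form y q - mink_form y p) *\<^sub>R p"
    have "?t \<in> mink_space n" using y p_props horosphere_props[OF q] by (intro mink_space_closed)
    hence "mink_form ?t d = 0"
      using t0[of ?t] p_props horosphere_props[OF q] by (simp add: mink_form_linear)
    thus "mink_form d y = 0"
      using pd d0[OF q] mink_form_sym[of d y] by (simp add: mink_form_linear)
  qed
  thus ?thesis by (simp add: d_def)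
qed

text \<open>The error \<open>\<mu> p\<close> in \<open>A v\<close> cancels: (v|q) = (A v|A q) = (v|A
  q) + \<mu>, so \<open>A\<close> carries the tangent vector at \<open>q\<close> exactly to the one
  at \<open>A q\<close>.\<close>

lemma parallel_flag_tangent:
  assumes L: "\<And>q. q \<in> horosphere n p \<Longrightarrow> L q = oriented_line (flag_tangent p v q)"
  shows "parallel_line_field n (horosphere n p) L"
  unfolding parallel_line_field_def
proof (intro allI impI ballI, elim conjE)
  fix A q assume A: "parabolic_translation n A" and S: "A ` horosphere n p = horosphere n p"
    and q: "q \<in> horosphere n p"
  have iso: "mink_isometry n A" using A by (simp add: parabolic_translation_def)
  hence lin: "linear A" by (simp add: mink_isometry_def)
  have Ap: "A p = p" using iso S q by (rule isometry_fixes_base)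
  have "p \<noteq> 0" using p by (simp add: light_cone_def)
  then obtain \<mu> where Av: "A v = v + \<mu> *\<^sub>R p"
    using parabolic_translation_flag[OF A _ _ _ v pv Ap] p_props by auto
  have Aq: "A q \<in> horosphere n p" using S q by blast
  have Aft: "A (flag_tangent p v q) = A v - mink_form v q *\<^sub>R A p"
    using lin by (simp add: flag_tangent_def linear_diff linear_scale)
  have "mink_form v q = mink_form (A v) (A q)"
    using iso v horosphere_props[OF q] by (auto simp: mink_isometry_def)
  also have "\<dots> = mink_form v (A q) + \<mu>"
    using horosphere_props[OF Aq] by (simp add: Av mink_form_linear)
  finally have "A (flag_tangent p v q) = flag_tangent p v (A q)"
    unfolding Aft by (simp add: flag_tangent_def Ap Av algebra_simps)
  thus "L (A q) = map_line A (L q)"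
    using L[OF Aq] L[OF q] map_line_oriented_line[OF lin] by simp
qed

end

section \<open>Upper half-space\<close>

text \<open>The solution of T - Z = 1/z, X = x/z and, from the hyperboloid equation, T + Z = z +
  |x|^2/z.\<close>

fun uhs_inv :: "real \<times> clifford \<Rightarrow> minkowski" where
  "uhs_inv (z, x) = ((z + (1 + (norm x)\<^sup>2) / z) / 2, (z + ((norm x)\<^sup>2 - 1) / z) / 2, (1 / z) *\<^sub>R x)"

declare uhs_inv.simps [simp del]

lemma uhs_map_uhs_inv:
  assumes "u \<in> uhs n"
  shows "uhs_map (uhs_inv u) = u"
proof -
  obtain z x where u: "u = (z, x)" "z > 0" using assms by (auto simp: uhs_def)
  have "fst (uhs_inv u) - fst (snd (uhs_inv u)) = 1 / z"
    by (simp add: u uhs_inv.simps diff_divide_distrib add_divide_distrib)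
  thus ?thesis using u by (simp add: uhs_inv.simps)
qed

lemma mink_form_uhs_inv:
  assumes "z > 0"
  shows "mink_form (uhs_inv (z, x)) (T, Z, X)
    = ((z\<^sup>2 + (norm x)\<^sup>2) * (T - Z) + (T + Z) - 2 * inner x X) / (2 * z)"
  using assms by (simp add: mink_form_eq uhs_inv.simps field_simps power2_eq_square[of z])

lemma uhs_inv_in_hyperboloid:
  assumes "u \<in> uhs n"
  shows "uhs_inv u \<in> hyperboloid n"
proof -
  obtain z x where u: "u = (z, x)" "z > 0" "x \<in> paravectors n"
    using assms by (auto simp: uhs_def)
  have "z + (1 + (norm x)\<^sup>2) / z > 0" using u by (simp add: add_pos_nonneg)
  moreover have "mink_form (uhs_inv u) (uhs_inv u) = 1"
    using u(2) unfolding u(1) uhs_inv.simps(1)[of z x, THEN arg_cong, of "mink_form (uhs_inv (z, x))"]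
      mink_form_uhs_inv[OF u(2)]
    by (simp add: field_simps power2_eq_square[of z] flip: power2_norm_eq_inner)
  ultimately show ?thesis
    using u by (simp add: uhs_inv.simps hyperboloid_def mink_space_def scaleR_in_paravectors)
qed

lemma uhs_inv_uhs_map:
  assumes "q \<in> hyperboloid n"
  shows "uhs_inv (uhs_map q) = q" "uhs_map q \<in> uhs n"
proof -
  obtain T Z X where q: "q = (T, Z, X)" by (cases q)
  have s: "T - Z > 0" using assms hyperboloid_height_pos q by blast
  have X: "(T - Z) * (T + Z) = 1 + (norm X)\<^sup>2"
    using assms by (simp add: q hyperboloid_def mink_form_eq algebra_simps power2_norm_eq_inner)
  have n: "(norm ((1 / (T - Z)) *\<^sub>R X))\<^sup>2 = (norm X)\<^sup>2 / (T - Z)\<^sup>2"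
    by (simp add: power_divide)
  define s w where "s = T - Z" and "w = T + Z"
  have sw: "T = (s + w) / 2" "Z = (w - s) / 2" "(norm X)\<^sup>2 = s * w - 1" "s > 0"
    using X s by (simp_all add: s_def w_def)
  have "1 / s + (1 + (s * w - 1) / s\<^sup>2) * s = s + w" "1 / s + ((s * w - 1) / s\<^sup>2 - 1) * s = w - s"
    using sw(4) by (simp_all add: field_simps power2_eq_square)
  thus "uhs_inv (uhs_map q) = q"
    using s n by (simp add: q uhs_inv.simps s_def[symmetric] sw(3)) (simp add: sw(1,2))
  show "uhs_map q \<in> uhs n"
    using s assms by (simp add: q uhs_def hyperboloid_def mink_space_def scaleR_in_paravectors)
qed

lemma the_inv_into_uhs_map:
  assumes "q \<in> hyperboloid n"
  shows "the_inv_into (hyperboloid n) uhs_map (uhs_map q) = q"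
  by (rule the_inv_into_f_f[OF inj_on_inverseI[of _ uhs_inv] assms]) (rule uhs_inv_uhs_map)

lemma uhs_map_horosphere:
  "uhs_map ` horosphere n p = {u \<in> uhs n. mink_form (uhs_inv u) p = 1}"
proof (intro equalityI subsetI)
  fix u assume "u \<in> uhs_map ` horosphere n p"
  thus "u \<in> {u \<in> uhs n. mink_form (uhs_inv u) p = 1}"
    using uhs_inv_uhs_map by (auto simp: horosphere_def)
next
  fix u assume "u \<in> {u \<in> uhs n. mink_form (uhs_inv u) p = 1}"
  hence "uhs_inv u \<in> horosphere n p" "uhs_map (uhs_inv u) = u"
    using uhs_inv_in_hyperboloid uhs_map_uhs_inv unfolding horosphere_def by blast+
  thus "u \<in> uhs_map ` horosphere n p" by (metis imageI)
qed

text \<open>Its Hermitian matrix has the entries k |c|^2, k c, k \<open>cconj c\<close>, k; in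
  particular T - Z = 2k and the boundary point is \<open>c\<close> when \<open>k\<close> is
  non-zero.\<close>

definition finite_null :: "real \<Rightarrow> clifford \<Rightarrow> minkowski" where
  "finite_null k c = (k * ((norm c)\<^sup>2 + 1), k * ((norm c)\<^sup>2 - 1), (2 * k) *\<^sub>R c)"

lemma finite_null_in_light_cone:
  assumes "k > 0" "c \<in> paravectors n"
  shows "finite_null k c \<in> light_cone n"
proof -
  have "(norm c)\<^sup>2 + 1 > 0" by (simp add: add_nonneg_pos)
  moreover have "mink_form (finite_null k c) (finite_null k c) = 0"
    by (simp add: finite_null_def mink_form_eq power2_norm_eq_inner algebra_simps)
  ultimately show ?thesis
    using assms by (simp add: light_cone_def finite_null_def mink_space_def zero_prod_def
        scaleR_in_paravectors)
qed

text \<open>The horosphere equation becomes z^2 + |x - c|^2 = z/k; completing the square gives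
  centre height and radius 1/(2k).\<close>

lemma uhs_map_horosphere_finite:
  assumes "k > 0" "c \<in> paravectors n"
  shows "uhs_map ` horosphere n (finite_null k c) = tangent_sphere n c (1 / k)"
  unfolding uhs_map_horosphere tangent_sphere_def
proof (intro Collect_cong conj_cong refl)
  fix u assume "u \<in> uhs n"
  then obtain z x where u: "u = (z, x)" "z > 0" by (auto simp: uhs_def)
  define D where "D = (dist x c)\<^sup>2"
  define r where "r = 1 / k / 2"
  have k: "k = 1 / (2 * r)" and r: "r > 0" using assms by (simp_all add: r_def)
  have D: "(norm x)\<^sup>2 + (norm c)\<^sup>2 - 2 * inner x c = D"
    by (simp add: D_def dist_norm power2_norm_eq_inner inner_diff_left inner_diff_right inner_commute)
  have "mink_form (uhs_inv u) (finite_null k c)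
      = k * (z\<^sup>2 + ((norm x)\<^sup>2 + (norm c)\<^sup>2 - 2 * inner x c)) / z"
    unfolding u finite_null_def mink_form_uhs_inv[OF u(2)] using u by (simp add: field_simps)
  hence "mink_form (uhs_inv u) (finite_null k c) = (z\<^sup>2 + D) / (2 * r * z)"
    unfolding D by (simp add: k)
  hence "mink_form (uhs_inv u) (finite_null k c) = 1 \<longleftrightarrow> z\<^sup>2 + D = 2 * r * z"
    using u(2) r by auto
  also have "\<dots> \<longleftrightarrow> (z - r)\<^sup>2 + D = r\<^sup>2"
    unfolding power2_diff by (auto simp: algebra_simps)
  also have "\<dots> \<longleftrightarrow> sqrt ((z - r)\<^sup>2 + D) = r"
  proof -
    have "(z - r)\<^sup>2 + D \<ge> 0" by (simp add: D_def)
    thus ?thesis using r by (metis real_sqrt_pow2 real_sqrt_unique less_imp_le)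
  qed
  also have "sqrt ((z - r)\<^sup>2 + D) = dist u (r, c)"
    by (simp add: u D_def dist_Pair_Pair dist_real_def)
  finally show "mink_form (uhs_inv u) (finite_null k c) = 1 \<longleftrightarrow> dist u (1 / k / 2, c) = 1 / k / 2"
    unfolding r_def .
qed

lemma uhs_map_horosphere_infinity:
  "uhs_map ` horosphere n (h, h, 0) = horizontal_plane n h"
  unfolding uhs_map_horosphere horizontal_plane_def
proof (intro Collect_cong conj_cong refl)
  fix u assume "u \<in> uhs n"
  then obtain z x where u: "u = (z, x)" "z > 0" by (auto simp: uhs_def)
  have "mink_form (uhs_inv u) (h, h, 0) = h / z"
    unfolding u mink_form_uhs_inv[OF u(2)] by simp
  thus "mink_form (uhs_inv u) (h, h, 0) = 1 \<longleftrightarrow> fst u = h" using u by auto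
qed

text \<open>A vector with equal T and Z components leaves T - Z, and hence the height, stationary.
  All flag tangents evaluated below have this form.\<close>

lemma frechet_derivative_uhs_map:
  assumes "T - Z \<noteq> 0"
  shows "linear (frechet_derivative uhs_map (at (T, Z, X)))"
    "frechet_derivative uhs_map (at (T, Z, X)) (a, a, Y) = (0, (1 / (T - Z)) *\<^sub>R Y)"
proof -
  let ?s = "\<lambda>p :: minkowski. fst p - fst (snd p)"
  have e: "uhs_map = (\<lambda>p. (inverse (?s p), inverse (?s p) *\<^sub>R snd (snd p)))"
    by (auto simp: inverse_eq_divide)
  let ?i = "\<lambda>t. - (inverse (T - Z) * ?s t * inverse (T - Z))"
  have d: "(uhs_map has_derivative
      (\<lambda>t. (?i t, inverse (T - Z) *\<^sub>R snd (snd t) + ?i t *\<^sub>R X))) (at (T, Z, X))"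
    unfolding e using assms by (auto intro!: derivative_eq_intros)
  have f: "frechet_derivative uhs_map (at (T, Z, X))
      = (\<lambda>t. (?i t, inverse (T - Z) *\<^sub>R snd (snd t) + ?i t *\<^sub>R X))"
    using frechet_derivative_at[OF d] by simp
  show "linear (frechet_derivative uhs_map (at (T, Z, X)))"
    unfolding f using d by (rule has_derivative_linear)
  show "frechet_derivative uhs_map (at (T, Z, X)) (a, a, Y) = (0, (1 / (T - Z)) *\<^sub>R Y)"
    unfolding f by (simp add: inverse_eq_divide)
qed

lemma oriented_line_scaleR:
  assumes "r > 0"
  shows "oriented_line (r *\<^sub>R v) = oriented_line v"
proof -
  have "(\<lambda>c. c *\<^sub>R r *\<^sub>R v) ` C = (\<lambda>c. c *\<^sub>R v) ` ((\<lambda>c. c * r) ` C)" for C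
    by (simp add: image_image)
  moreover have "(\<lambda>c. c * r) ` UNIV = UNIV"
    by (rule surjI[of _ "\<lambda>c. c / r"]) (use assms in simp)
  moreover have "(\<lambda>c. c * r) ` {c. c > 0} = {c. c > 0}"
  proof (intro equalityI subsetI)
    fix c :: real assume "c \<in> {c. c > 0}"
    thus "c \<in> (\<lambda>c. c * r) ` {c. c > 0}" using assms by (intro image_eqI[of _ _ "c / r"]) auto
  qed (use assms in auto)
  ultimately show ?thesis by (simp add: oriented_line_def span_singleton setcompr_eq_image)
qed

section \<open>The multiflag of a spinor\<close>

lemma mink_of_matrix_eq:
  assumes "p \<in> mink_space n" "mink_matrix p = M"
  shows "mink_of_matrix n M = p"
  unfolding mink_of_matrix_def
  using inj_on_subset[OF inj_mink_matrix subset_UNIV] assms by (intro the_inv_into_f_eq)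

text \<open>The entries are given by equations, so that evaluating the partial inverse of
  \<open>mink_matrix\<close> reduces to four entrywise identities.\<close>

lemma mink_of_matrix_vector:
  assumes "X \<in> paravectors n" "a = ((T + Z) / 2) *\<^sub>R 1" "b = (1 / 2) *\<^sub>R X" "b' = cconj b"
    "d = ((T - Z) / 2) *\<^sub>R 1"
  shows "mink_of_matrix n (vector [vector [a, b], vector [b', d]]) = (T, Z, X)"
  by (rule mink_of_matrix_eq)
     (use assms in \<open>simp_all add: mink_space_def vec_eq_iff forall_2 of_real_def cconj_scaleR
       del: of_real_add of_real_diff\<close>)

lemma vector_matrix_add:
  fixes a b c d :: "'a :: real_vector"
  shows "vector [vector [a, b], vector [c, d]] + vector [vector [a', b'], vector [c', d']]
    = (vector [vector [a + a', b + b'], vector [c + c', d + d']] :: 'a ^ 2 ^ 2)"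
  by (simp add: vec_eq_iff forall_2)

text \<open>Every entry contains the real scalar \<open>\<eta> * cconj \<eta>\<close>; what remains
  is \<open>c * cconj c\<close>, \<open>c\<close>, \<open>cconj c\<close> and 1.\<close>

lemma phi1_finite:
  assumes \<eta>: "\<eta> \<in> lipschitz_group n" and c: "c \<in> paravectors n"
  shows "phi1 n (c * \<eta>, \<eta>) = finite_null ((norm \<eta>)\<^sup>2) c"
proof -
  note N = lipschitz_group_norm(1)[OF \<eta>]
  have "c * \<eta> * cconj (c * \<eta>) = c * (\<eta> * cconj \<eta>) * cconj c"
    "c * \<eta> * cconj \<eta> = c * (\<eta> * cconj \<eta>)" "\<eta> * cconj (c * \<eta>) = \<eta> * cconj \<eta> * cconj c"
    by (simp_all add: cconj_mult mult.assoc)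
  thus ?thesis
    unfolding phi1_def finite_null_def col_dagger.simps N
    by (intro mink_of_matrix_vector)
       (use c N in \<open>simp_all add: scaleR_in_paravectors cconj_scaleR paravector_mult_cconj algebra_simps\<close>)
qed

text \<open>As \<open>grade_inv (c * \<eta>) = cconj c * grade_inv \<eta>\<close>, every entry is a
  word in \<open>c\<close>, \<open>Q\<close> and their conjugates. The polarised relation makes the
  diagonal real, and the sandwich formula resolves \<open>c * Q * c\<close> off it.\<close>

lemma dphi1_finite:
  assumes \<eta>: "\<eta> \<in> lipschitz_group n" and c: "c \<in> paravectors n" and j: "j \<in> {1..n}"
  defines "Q \<equiv> \<eta> * gen j * reversal \<eta>"
  defines "r \<equiv> inner c (cconj Q)"
  shows "dphi1 n (c * \<eta>, \<eta>) (spinor_rmult (spinor_check (c * \<eta>, \<eta>)) (gen j))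
    = (0, - 4 * r, (4 * r) *\<^sub>R c - (2 * (1 + (norm c)\<^sup>2)) *\<^sub>R cconj Q)"
proof -
  have Q: "Q \<in> paravectors n"
    unfolding Q_def using \<eta> gen_in_paravectors[OF j] by (rule lipschitz_group_sandwich)
  have cQ: "cconj Q \<in> paravectors n" "cconj c \<in> paravectors n"
    using Q c by (auto intro: cconj_in_paravectors)
  let ?x = "grade_inv \<eta> * gen j" and ?y = "- grade_inv (c * \<eta>) * gen j"
  have e: "c * \<eta> * cconj ?x = - (c * Q)" "?x * cconj (c * \<eta>) = - (cconj Q * cconj c)"
    "c * \<eta> * cconj ?y = c * Q * c" "?x * cconj \<eta> = - cconj Q"
    "\<eta> * cconj ?x = - Q" "?y * cconj (c * \<eta>) = cconj c * cconj Q * cconj c"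
    "\<eta> * cconj ?y = Q * c" "?y * cconj \<eta> = cconj c * cconj Q"
    by (simp_all add: Q_def cconj_mult cconj_minus grade_inv_mult reversal_mult mult.assoc
        reversal_paravector[OF c] grade_inv_paravector[OF c])
  have 1: "c * Q + cconj Q * cconj c = (2 * r) *\<^sub>R 1"
    using paravector_mult_cconj_add[OF c cQ(1)] by (simp add: r_def)
  \<comment> \<open>Conjugation preserves inner products, so the same \<open>r\<close> appears as in
    \<open>1\<close> and the two diagonal entries are opposite: T = 0.\<close>
  have 2: "Q * c + cconj c * cconj Q = (2 * r) *\<^sub>R 1"
    using paravector_mult_cconj_add[OF Q cQ(2)] inner_cconj[of Q "cconj c"]
    by (simp add: r_def inner_commute)
  have 3: "c * Q * c = (2 * r) *\<^sub>R c - (norm c)\<^sup>2 *\<^sub>R cconj Q"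
    using paravector_sandwich[OF c Q] by (simp add: r_def)
  show ?thesis
    unfolding dphi1_def spinor_check.simps spinor_rmult.simps col_dagger.simps vector_matrix_add e
  proof (rule mink_of_matrix_vector)
    show "(4 * r) *\<^sub>R c - (2 * (1 + (norm c)\<^sup>2)) *\<^sub>R cconj Q \<in> paravectors n"
      using c cQ by (intro diff_in_paravectors scaleR_in_paravectors)
    have "- (c * Q) + - (cconj Q * cconj c) = - (c * Q + cconj Q * cconj c)" by simp
    also have "\<dots> = ((0 + - 4 * r) / 2) *\<^sub>R 1" unfolding 1 by simp
    finally show "- (c * Q) + - (cconj Q * cconj c) = ((0 + - 4 * r) / 2) *\<^sub>R 1" .
    show "Q * c + cconj c * cconj Q = ((0 - - 4 * r) / 2) *\<^sub>R 1" using 2 by simp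
    show "c * Q * c + - cconj Q
        = (1 / 2) *\<^sub>R ((4 * r) *\<^sub>R c - (2 * (1 + (norm c)\<^sup>2)) *\<^sub>R cconj Q)"
      unfolding 3 by (simp add: algebra_simps)
    show "- Q + cconj c * cconj Q * cconj c = cconj (c * Q * c + - cconj Q)"
      by (simp add: cconj_diff cconj_mult mult.assoc)
  qed
qed

lemma phi1_infinity:
  assumes \<xi>: "\<xi> \<in> lipschitz_group n"
  shows "phi1 n (\<xi>, 0) = ((norm \<xi>)\<^sup>2, (norm \<xi>)\<^sup>2, 0)"
  unfolding phi1_def col_dagger.simps lipschitz_group_norm(1)[OF \<xi>]
  by (intro mink_of_matrix_vector) simp_all

lemma dphi1_infinity:
  assumes \<xi>: "\<xi> \<in> lipschitz_group n" and j: "j \<in> {1..n}"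
  shows "dphi1 n (\<xi>, 0) (spinor_rmult (spinor_check (\<xi>, 0)) (gen j))
    = (0, 0, 2 *\<^sub>R (\<xi> * gen j * reversal \<xi>))"
  unfolding dphi1_def spinor_check.simps spinor_rmult.simps col_dagger.simps vector_matrix_add
  using lipschitz_group_sandwich[OF \<xi> gen_in_paravectors[OF j]]
  by (intro mink_of_matrix_vector scaleR_in_paravectors)
     (simp_all add: cconj_mult cconj_minus mult.assoc)

text \<open>At the north pole (v|q) = 2r/k, just the multiple of \<open>p\<close> that removes the
  \<open>c\<close> term from \<open>v\<close>; the T and Z components then agree.\<close>

lemma flagged_horosphere_finite:
  assumes k: "k > 0" and c: "c \<in> paravectors n" and R: "R \<in> paravectors n" "R \<noteq> 0"
  defines "r \<equiv> inner c R"
  defines "v \<equiv> (0, - 4 * r, (4 * r) *\<^sub>R c - (2 * (1 + (norm c)\<^sup>2)) *\<^sub>R R)"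
  shows "flagged_horosphere n (finite_null k c) v"
    "flag_tangent (finite_null k c) v (uhs_inv (1 / k, c))
      = (- 2 * r * ((norm c)\<^sup>2 + 1), - 2 * r * ((norm c)\<^sup>2 + 1), - (2 * (1 + (norm c)\<^sup>2)) *\<^sub>R R)"
proof -
  define X where "X = (4 * r) *\<^sub>R c - (2 * (1 + (norm c)\<^sup>2)) *\<^sub>R R"
  have v: "v = (0, - 4 * r, X)" by (simp add: v_def X_def)
  have cX: "inner c X = 2 * r * ((norm c)\<^sup>2 - 1)"
    unfolding X_def inner_diff_right inner_scaleR_right r_def[symmetric] power2_norm_eq_inner
    by (simp add: algebra_simps)
  show "flagged_horosphere n (finite_null k c) v"
  proof
    show "finite_null k c \<in> light_cone n" using k c by (rule finite_null_in_light_cone)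
    show "v \<in> mink_space n"
      using c R by (auto simp: v_def mink_space_def intro!: diff_in_paravectors scaleR_in_paravectors)
    show "mink_form (finite_null k c) v = 0"
      by (simp add: finite_null_def v mink_form_eq cX algebra_simps)
    \<comment> \<open>-(v|v) is 16 r^2 + |X|^2, and for r = 0 the vector X is a non-zero multiple of
      \<open>R\<close>.\<close>
    have "r \<noteq> 0 \<or> X \<noteq> 0"
      using R add_pos_nonneg[of 1 "(norm c)\<^sup>2"] by (auto simp: X_def)
    hence "r * r > 0 \<or> inner X X > 0" by (simp add: zero_less_mult_iff) linarith
    moreover have "r * r \<ge> 0" "inner X X \<ge> 0" by simp_all
    ultimately have "16 * (r * r) + inner X X > 0" by linarith
    thus "mink_form v v < 0" by (simp add: v mink_form_eq)
  qed
  have "mink_form v (uhs_inv (1 / k, c)) = mink_form (uhs_inv (1 / k, c)) v"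
    by (rule mink_form_sym)
  also have "\<dots> = 2 * r / k"
    unfolding v
    by (subst mink_form_uhs_inv) (use k in \<open>simp_all add: cX field_simps power2_eq_square[of k]\<close>)
  finally show "flag_tangent (finite_null k c) v (uhs_inv (1 / k, c))
      = (- 2 * r * ((norm c)\<^sup>2 + 1), - 2 * r * ((norm c)\<^sup>2 + 1), - (2 * (1 + (norm c)\<^sup>2)) *\<^sub>R R)"
    using k by (simp add: flag_tangent_def finite_null_def v_def algebra_simps)
qed

lemma flagged_horosphere_infinity:
  assumes "h > 0" "R \<in> paravectors n" "R \<noteq> 0"
  shows "flagged_horosphere n (h, h, 0) (0, 0, R)"
  by standard (use assms in \<open>auto simp: light_cone_def mink_space_def mink_form_eq zero_prod_def\<close>)

lemma infinity_in_light_cone: "h > 0 \<Longrightarrow> (h, h, 0) \<in> light_cone n"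
  by (simp add: light_cone_def mink_space_def mink_form_eq zero_prod_def)

section \<open>Assembly of the decorated horosphere\<close>

lemma Phi_eq:
  assumes w: "\<And>j. j \<in> {1..n} \<Longrightarrow> dphi1 n \<kappa> (spinor_rmult (spinor_check \<kappa>) (gen j)) = w j"
    and fl: "\<And>j. j \<in> {1..n} \<Longrightarrow> flagged_horosphere n (phi1 n \<kappa>) (w j)"
  shows "Phi n \<kappa> = (horosphere n (phi1 n \<kappa>), \<lambda>j\<in>{1..n}. \<lambda>q\<in>horosphere n (phi1 n \<kappa>).
    oriented_line (flag_tangent (phi1 n \<kappa>) (w j) q))"
  unfolding Phi_def Phi1_def multiflag_def Phi2.simps
  using flagged_horosphere.flag_line_eq[OF fl] w
  by (auto simp: restrict_def fun_eq_iff)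

lemma oriented_line_field_flag_tangent:
  assumes "flagged_horosphere n p v"
    and "\<And>q. q \<in> horosphere n p \<Longrightarrow> L q = oriented_line (flag_tangent p v q)"
  shows "oriented_line_field (horosphere n p) L"
  unfolding oriented_line_field_def
  using flagged_horosphere.flag_tangent_props(5,6)[OF assms(1)] assms(2) by blast

text \<open>The differential scales Y by 1/(T - Z) > 0, which an oriented line does not see, so the
  result is independent of the point.\<close>

lemma to_uhs_line:
  assumes "H \<subseteq> hyperboloid n" "q \<in> H" "j \<in> {1..n}" "L j q = oriented_line (a, a, Y)"
  shows "snd (to_uhs n (H, L)) j (uhs_map q) = oriented_line (0, Y)"
proof -
  have q: "q \<in> hyperboloid n" using assms by blast
  obtain T Z X where q': "q = (T, Z, X)" by (cases q)
  have pos: "T - Z > 0" using q hyperboloid_height_pos unfolding q' by blast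
  have "snd (to_uhs n (H, L)) j (uhs_map q)
      = map_line (frechet_derivative uhs_map (at q)) (oriented_line (a, a, Y))"
    using assms the_inv_into_uhs_map[OF q] by (simp add: to_uhs_def)
  also have "\<dots> = oriented_line ((1 / (T - Z)) *\<^sub>R (0, Y))"
    using pos frechet_derivative_uhs_map[of T Z X] by (simp add: map_line_oriented_line q')
  also have "\<dots> = oriented_line (0, Y)" using pos by (intro oriented_line_scaleR) simp
  finally show ?thesis .
qed

text \<open>The part common to finite and infinite centres; the cases differ only in
  \<open>p\<close>, \<open>w\<close> and the points at which the flag tangent has the form (a, a,
  Y).\<close>

lemma to_uhs_Phi:
  assumes HL: "Phi n \<kappa> = (H, L)" and SM: "to_uhs n (H, L) = (S, M)"
    and p: "phi1 n \<kappa> = p" "p \<in> light_cone n"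
    and w: "\<forall>j\<in>{1..n}. dphi1 n \<kappa> (spinor_rmult (spinor_check \<kappa>) (gen j)) = w j"
    and fl: "\<forall>j\<in>{1..n}. flagged_horosphere n p (w j)"
  shows "S = uhs_map ` horosphere n p" "horosphere_centred_at n S (boundary_point p)"
    "\<forall>j\<in>{1..n}. oriented_line_field H (L j) \<and> parallel_line_field n H (L j)"
    "\<And>j q a Y. j \<in> {1..n} \<Longrightarrow> q \<in> horosphere n p \<Longrightarrow> flag_tangent p (w j) q = (a, a, Y) \<Longrightarrow>
      M j (uhs_map q) = oriented_line (0, Y)"
proof -
  note fl' = fl[rule_format]
  note eq = Phi_eq[OF w[rule_format] fl'[folded p(1)], unfolded p(1) HL]
  have H: "H = horosphere n p" using eq by simp
  have L: "L j q = oriented_line (flag_tangent p (w j) q)"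
    if "j \<in> {1..n}" "q \<in> horosphere n p" for j q
    using eq that by simp
  show S: "S = uhs_map ` horosphere n p"
    using SM by (simp add: to_uhs_def H)
  thus "horosphere_centred_at n S (boundary_point p)"
    using p by (auto simp: horosphere_centred_at_def)
  show "\<forall>j\<in>{1..n}. oriented_line_field H (L j) \<and> parallel_line_field n H (L j)"
    unfolding H using oriented_line_field_flag_tangent[OF fl' L]
      flagged_horosphere.parallel_flag_tangent[OF fl' L] by simp
  show "M j (uhs_map q) = oriented_line (0, Y)"
    if "j \<in> {1..n}" "q \<in> horosphere n p" "flag_tangent p (w j) q = (a, a, Y)" for j q a Y
  proof -
    have "H \<subseteq> hyperboloid n" by (auto simp: H horosphere_def)
    thus ?thesis using to_uhs_line[of H n q j L a Y] L that by (simp add: SM[unfolded H] H)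
  qed
qed

theorem mainTheorem1:
  fixes n :: nat and \<xi> \<eta> :: clifford
  assumes "(\<xi>, \<eta>) \<in> spinors n"
  shows "let (H, L) = Phi n (\<xi>, \<eta>); (S, M) = to_uhs n (H, L) in
    horosphere_centred_at n S (if \<eta> = 0 then Infinity else Finite (\<xi> * cinv \<eta>)) \<and>
    (\<forall>j\<in>{1..n}. oriented_line_field H (L j) \<and> parallel_line_field n H (L j)) \<and>
    (\<eta> \<noteq> 0 \<longrightarrow>
      S = tangent_sphere n (\<xi> * cinv \<eta>) (1 / cnorm_sq \<eta>) \<and>
      euclidean_diameter S (1 / cnorm_sq \<eta>) \<and>
      (\<forall>j\<in>{1..n}. north_pole_specified_by n S (M j) (grade_inv \<eta> * gen j * cconj \<eta>))) \<and>
    (\<eta> = 0 \<longrightarrow>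
      S = horizontal_plane n (cnorm_sq \<xi>) \<and>
      (\<forall>j\<in>{1..n}. specified_by n S (M j) (\<xi> * gen j * reversal \<xi>)))"
proof -
  obtain H L S M where HL: "Phi n (\<xi>, \<eta>) = (H, L)" and SM: "to_uhs n (H, L) = (S, M)"
    by (metis surj_pair)
  show ?thesis
  proof (cases "\<eta> = 0")
    case False
    hence \<eta>: "\<eta> \<in> lipschitz_group n" and \<xi>\<eta>: "\<xi> * cconj \<eta> \<in> paravectors n"
      using assms by (auto simp: spinors_def)
    define k where "k = (norm \<eta>)\<^sup>2"
    have k: "k > 0" "cnorm_sq \<eta> = k" using False by (simp_all add: k_def cnorm_sq_eq_norm)
    define c where "c = \<xi> * cinv \<eta>"
    \<comment> \<open>The spinor condition enters here, since \<open>c\<close> is \<xi>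
      \<open>cconj \<eta>\<close> / |\<eta>|^2.\<close>
    have c: "c \<in> paravectors n"
      using \<xi>\<eta> by (simp add: c_def cinv_lipschitz_group[OF \<eta>] scaleR_in_paravectors)
    have \<xi>: "\<xi> = c * \<eta>"
      using False lipschitz_group_norm(2)[OF \<eta>]
      by (simp add: c_def cinv_lipschitz_group[OF \<eta>] mult.assoc)
    define R where "R j = cconj (\<eta> * gen j * reversal \<eta>)" for j
    have R: "R j \<in> paravectors n" "R j \<noteq> 0" if "j \<in> {1..n}" for j
    proof -
      show "R j \<in> paravectors n"
        unfolding R_def
        by (intro cconj_in_paravectors lipschitz_group_sandwich[OF \<eta>] gen_in_paravectors that)
      show "R j \<noteq> 0"
        unfolding R_def
        by (metis lipschitz_group_sandwich_nonzero[OF \<eta> gen_nonzero] cconj_cconj cconj_zero)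
    qed
    \<comment> \<open>Conjugation reverses the factors and changes the sign of \<open>gen j\<close>,
      which accounts for the minus.\<close>
    have D: "grade_inv \<eta> * gen j * cconj \<eta> = - R j" for j
      by (simp add: R_def cconj_mult mult.assoc)
    have p: "phi1 n (\<xi>, \<eta>) = finite_null k c"
      unfolding \<xi> k_def by (rule phi1_finite[OF \<eta> c])
    define w where "w j = (0 :: real, - 4 * inner c (R j),
      (4 * inner c (R j)) *\<^sub>R c - (2 * (1 + (norm c)\<^sup>2)) *\<^sub>R R j)" for j
    have w: "\<forall>j\<in>{1..n}. dphi1 n (\<xi>, \<eta>) (spinor_rmult (spinor_check (\<xi>, \<eta>)) (gen j)) = w j"
      unfolding \<xi> w_def R_def using dphi1_finite[OF \<eta> c] by blast
    have fl: "\<forall>j\<in>{1..n}. flagged_horosphere n (finite_null k c) (w j)"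
      unfolding w_def using flagged_horosphere_finite(1)[OF k(1) c R] by blast
    note facts = to_uhs_Phi[OF HL SM p finite_null_in_light_cone[OF k(1) c] w fl]
    have S: "S = tangent_sphere n c (1 / k)"
      unfolding facts(1) using k(1) c by (rule uhs_map_horosphere_finite)
    have pole: "north_pole S u \<longleftrightarrow> u = (1 / k, c)" for u
      unfolding S using k c by (intro north_pole_tangent_sphere) simp_all
    hence "(1 / k, c) \<in> S" by (metis north_pole_def is_arg_max_def)
    then obtain q where q: "q \<in> horosphere n (finite_null k c)" "uhs_map q = (1 / k, c)"
      unfolding facts(1) by (metis imageE)
    hence q_inv: "q = uhs_inv (1 / k, c)"
      using uhs_inv_uhs_map(1)[of q n] by (simp add: horosphere_def)
    have "M j (1 / k, c) = oriented_line (0, - R j)" if j: "j \<in> {1..n}" for j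
    proof -
      have "M j (uhs_map q) = oriented_line (0, - (2 * (1 + (norm c)\<^sup>2)) *\<^sub>R R j)"
        by (rule facts(4)[OF j q(1)], unfold q_inv w_def, rule flagged_horosphere_finite(2)[OF k(1) c R[OF j]])
      \<comment> \<open>Only the positive factor may be dropped; the sign stays with
        \<open>R j\<close>.\<close>
      also have "(0, - (2 * (1 + (norm c)\<^sup>2)) *\<^sub>R R j) = (2 * (1 + (norm c)\<^sup>2)) *\<^sub>R (0 :: real, - R j)"
        by (simp add: algebra_simps)
      also have "oriented_line \<dots> = oriented_line (0, - R j)"
        by (intro oriented_line_scaleR) (simp add: add_pos_nonneg)
      finally show ?thesis unfolding q(2) .
    qed
    hence "north_pole_specified_by n S (M j) (- R j)" if "j \<in> {1..n}" for j
      unfolding north_pole_specified_by_def pole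
      using that R[OF that] scaleR_in_paravectors[of "R j" n "-1"] by simp
    moreover have "euclidean_diameter S (1 / k)" by (simp add: euclidean_diameter_def pole)
    moreover have "boundary_point (finite_null k c) = Finite c"
      using k by (simp add: finite_null_def algebra_simps)
    ultimately show ?thesis
      unfolding HL Let_def prod.case SM
      using facts(2,3) S k False by (simp add: D c_def)
  next
    case True
    hence \<xi>: "\<xi> \<in> lipschitz_group n" using assms by (auto simp: spinors_def)
    define h where "h = (norm \<xi>)\<^sup>2"
    have h: "h > 0" "cnorm_sq \<xi> = h"
      using lipschitz_group_norm(3)[OF \<xi>] by (simp_all add: h_def cnorm_sq_eq_norm)
    define D where "D j = \<xi> * gen j * reversal \<xi>" for j
    have D: "D j \<in> paravectors n" "D j \<noteq> 0" if "j \<in> {1..n}" for j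
      using lipschitz_group_sandwich[OF \<xi> gen_in_paravectors[OF that]]
        lipschitz_group_sandwich_nonzero[OF \<xi> gen_nonzero] by (simp_all add: D_def)
    have p: "phi1 n (\<xi>, \<eta>) = (h, h, 0)"
      unfolding True h_def by (rule phi1_infinity[OF \<xi>])
    have fl: "\<forall>j\<in>{1..n}. flagged_horosphere n (h, h, 0) (0, 0, 2 *\<^sub>R D j)"
      using h D by (intro ballI flagged_horosphere_infinity) (simp_all add: scaleR_in_paravectors)
    have w: "\<forall>j\<in>{1..n}. dphi1 n (\<xi>, \<eta>) (spinor_rmult (spinor_check (\<xi>, \<eta>)) (gen j))
        = (0, 0, 2 *\<^sub>R D j)"
      unfolding True D_def using dphi1_infinity[OF \<xi>] by blast
    note facts = to_uhs_Phi[OF HL SM p infinity_in_light_cone[OF h(1)] w fl]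
    have "specified_by n S (M j) (D j)" if j: "j \<in> {1..n}" for j
      unfolding specified_by_def
    proof (intro conjI ballI D[OF j])
      fix u assume "u \<in> S"
      then obtain q where q: "q \<in> horosphere n (h, h, 0)" "u = uhs_map q"
        unfolding facts(1) by blast
      \<comment> \<open>Here every flag tangent differs from (0, 0, 2 \<open>D j\<close>) by a
        multiple of (h, h, 0), so the direction is found at all points and not only at a
        pole.\<close>
      have "M j u = oriented_line (0, 2 *\<^sub>R D j)"
        unfolding q(2) by (rule facts(4)[OF j q(1)]) (simp add: flag_tangent_def)
      also have "(0, 2 *\<^sub>R D j) = 2 *\<^sub>R (0 :: real, D j)" by simp
      also have "oriented_line \<dots> = oriented_line (0, D j)" by (intro oriented_line_scaleR) simp
      finally show "M j u = oriented_line (0, D j)" .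
    qed
    moreover have "S = horizontal_plane n h"
      unfolding facts(1) by (rule uhs_map_horosphere_infinity)
    ultimately show ?thesis
      unfolding HL Let_def prod.case SM
      using facts(2,3) h True by (simp add: D_def)
  qed
qed

end
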